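(* Fix a positive integer $d$ and a sequence of $k$-ary CSPs $\{\mathrm{Max}\text{-}\Pi_n\}$ with $k\le d$. Suppose that, for every $n$, the $d$-round Sherali--Adams relaxation cannot achieve a $(c,s)$-approximation for $\mathrm{Max}\text{-}\Pi_n$. Then no sequence of LP relaxations of size at most $n^{d/2}$ can achieve a $(c,s)$-approximation for $\mathrm{Max}\text{-}\Pi_n$ for every $n$.
   Context: $\Pi$ is a finite collection of $k$-ary predicates $P\colon\{-1,1\}^k\to\{0,1\}$. An instance $\Im$ of $\mathrm{Max}\text{-}\Pi_n$ consists of variables $X_1,\ldots,X_n$ and constraints $P_1,\ldots,P_m$, each of the form $P_j(x)=P(x_{i_1},\ldots,x_{i_k})$ with $P\in\Pi$ and distinct $i_1,\ldots,i_k\in[n]$; $\Im(x)=\frac1m\sum_jP_j(x)$ for $x\in\{-1,1\}^n$ and $\mathrm{opt}(\Im)=\max_x\Im(x)$. An LP relaxation of size $R$ for $\mathrm{Max}\text{-}\Pi_n$: a number $D$, vectors $\tilde\Im,\tilde x\in\mathbb R^D$ for each instance $\Im$ and each $x\in\{-1,1\}^n$ with $\Im(x)=\langle\tilde\Im,\tilde x\rangle$, and a closed convex polyhedron $P\subseteq\mathbb R^D$ (independent of the instance) defined by $R$ linear inequalities and containing every $\tilde x$; its value is $\mathcal L(\Im)=\max_{y\in P}\langle\tilde\Im,y\rangle$. It achieves a $(c,s)$-approximation if $\mathcal L(\Im)\le c$ whenever $\mathrm{opt}(\Im)\le s$. With $\chi_\alpha(x)=\prod_{i\in\alpha}x_i$,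 a $d$-local expectation functional is a linear functional $\tilde{\mathbb E}$ on $n$-variate multilinear polynomials of degree $\le d$ with $\tilde{\mathbb E}1=1$ and $\tilde{\mathbb E}P\ge0$ for every such polynomial $P$ nonnegative on $\{-1,1\}^n$ and depending on only $d$ variables, extended to all functions by $\tilde{\mathbb E}\chi_\alpha=0$ for $|\alpha|>d$. The $d$-round Sherali--Adams value is $\mathtt{SA}_d(\Im)=\max_{\tilde{\mathbb E}}\tilde{\mathbb E}\Im$ over all $d$-local expectation functionals; the $d$-round Sherali--Adams relaxation achieves a $(c,s)$-approximation for $\mathrm{Max}\text{-}\Pi_n$ if $\mathtt{SA}_d(\Im)\le c$ for all instances with $\mathrm{opt}(\Im)\le s$. *)

theory Defs
  imports Complex_Main "HOL-Library.FuncSet" "HOL-Library.Extended_Real"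
    "Jordan_Normal_Form.Matrix"
begin

text \<open>The variables \<open>X\<^sub>1, \<dots>, X\<^sub>n\<close> are indexed by \<open>{..<n}\<close>.\<close>

definition hcube :: "nat \<Rightarrow> (nat \<Rightarrow> real) set" where
  "hcube n = {..<n} \<rightarrow>\<^sub>E {-1, 1}"

definition predicates :: "nat \<Rightarrow> ((nat \<Rightarrow> real) \<Rightarrow> real) set" where
  "predicates k = hcube k \<rightarrow>\<^sub>E {0, 1}"

text \<open>The pair \<open>(P, is)\<close> stands for the constraint \<open>P(x\<^bsub>is!0\<^esub>, \<dots>, x\<^bsub>is!(k-1)\<^esub>)\<close>;
  an instance is the list of its constraints.\<close>

type_synonym csp_constraint = "((nat \<Rightarrow> real) \<Rightarrow> real) \<times> nat list"
type_synonym csp_instance = "csp_constraint list"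

definition csp_constraints ::
    "((nat \<Rightarrow> real) \<Rightarrow> real) set \<Rightarrow> nat \<Rightarrow> nat \<Rightarrow> csp_constraint set" where
  "csp_constraints Preds k n =
     {(P, is). P \<in> Preds \<and> length is = k \<and> distinct is \<and> set is \<subseteq> {..<n}}"

definition csp_instances ::
    "((nat \<Rightarrow> real) \<Rightarrow> real) set \<Rightarrow> nat \<Rightarrow> nat \<Rightarrow> csp_instance set" where
  "csp_instances Preds k n = {I. I \<noteq> [] \<and> set I \<subseteq> csp_constraints Preds k n}"

fun constraint_val :: "csp_constraint \<Rightarrow> (nat \<Rightarrow> real) \<Rightarrow> real" where
  "constraint_val (P, is) x = P (\<lambda>j\<in>{..<length is}. x (is ! j))"

definition csp_val :: "csp_instance \<Rightarrow> (nat \<Rightarrow> real) \<Rightarrow> real" where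
  "csp_val I x = (\<Sum>C\<leftarrow>I. constraint_val C x) / real (length I)"

definition csp_opt :: "nat \<Rightarrow> csp_instance \<Rightarrow> real" where
  "csp_opt n I = Max (csp_val I ` hcube n)"

text \<open>A relaxation carries the polyhedron through its system of inequalities
  \<open>A y \<le> b\<close>, one row of \<open>A\<close> for each inequality.\<close>

record lp_relaxation =
  lp_dim :: nat
  lp_inst :: "csp_instance \<Rightarrow> real vec"
  lp_asg :: "(nat \<Rightarrow> real) \<Rightarrow> real vec"
  lp_mat :: "real mat"
  lp_rhs :: "real vec"

definition lp_size :: "lp_relaxation \<Rightarrow> nat" where
  "lp_size L = dim_row (lp_mat L)"

definition lp_polyhedron :: "lp_relaxation \<Rightarrow> real vec set" where
  "lp_polyhedron L = {y \<in> carrier_vec (lp_dim L). lp_mat L *\<^sub>v y \<le> lp_rhs L}"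

definition is_lp_relaxation ::
    "((nat \<Rightarrow> real) \<Rightarrow> real) set \<Rightarrow> nat \<Rightarrow> nat \<Rightarrow> lp_relaxation \<Rightarrow> bool" where
  "is_lp_relaxation Preds k n L \<longleftrightarrow>
     lp_mat L \<in> carrier_mat (lp_size L) (lp_dim L) \<and>
     lp_rhs L \<in> carrier_vec (lp_size L) \<and>
     (\<forall>I\<in>csp_instances Preds k n. lp_inst L I \<in> carrier_vec (lp_dim L)) \<and>
     (\<forall>x\<in>hcube n. lp_asg L x \<in> lp_polyhedron L) \<and>
     (\<forall>I\<in>csp_instances Preds k n. \<forall>x\<in>hcube n. csp_val I x = lp_inst L I \<bullet> lp_asg L x)"

text \<open>The supremum is taken in the extended reals, so that an unbounded program has
  value \<open>\<infinity>\<close>; a program that is bounded above attains it.\<close>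

definition lp_value :: "lp_relaxation \<Rightarrow> csp_instance \<Rightarrow> ereal" where
  "lp_value L I = (SUP y\<in>lp_polyhedron L. ereal (lp_inst L I \<bullet> y))"

definition lp_achieves ::
    "((nat \<Rightarrow> real) \<Rightarrow> real) set \<Rightarrow> nat \<Rightarrow> nat \<Rightarrow> lp_relaxation \<Rightarrow> real \<Rightarrow> real \<Rightarrow> bool" where
  "lp_achieves Preds k n L c s \<longleftrightarrow>
     (\<forall>I\<in>csp_instances Preds k n. csp_opt n I \<le> s \<longrightarrow> lp_value L I \<le> ereal c)"

definition chi :: "nat set \<Rightarrow> (nat \<Rightarrow> real) \<Rightarrow> real" where
  "chi \<alpha> x = (\<Prod>i\<in>\<alpha>. x i)"

text \<open>Multilinear polynomials are represented by the functions they induce on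
  \<open>hcube n\<close>, which determine them; values outside the cube are irrelevant.\<close>

definition multilinear_polys :: "nat \<Rightarrow> nat \<Rightarrow> ((nat \<Rightarrow> real) \<Rightarrow> real) set" where
  "multilinear_polys n d =
     {f. \<exists>p. \<forall>x\<in>hcube n. f x = (\<Sum>\<alpha> | \<alpha> \<subseteq> {..<n} \<and> card \<alpha> \<le> d. p \<alpha> * chi \<alpha> x)}"

definition depends_on :: "nat \<Rightarrow> nat set \<Rightarrow> ((nat \<Rightarrow> real) \<Rightarrow> real) \<Rightarrow> bool" where
  "depends_on n S f \<longleftrightarrow>
     (\<forall>x\<in>hcube n. \<forall>y\<in>hcube n. (\<forall>i\<in>S. x i = y i) \<longrightarrow> f x = f y)"

text \<open>The functional is taken in its extended form, as a linear functional on all real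
  functions on \<open>hcube n\<close>. The first condition says that it sees only the values on the
  cube, and the last one that it is the extension by zero of its restriction to polynomials
  of degree at most \<open>d\<close>.\<close>

definition local_expectation ::
    "nat \<Rightarrow> nat \<Rightarrow> (((nat \<Rightarrow> real) \<Rightarrow> real) \<Rightarrow> real) \<Rightarrow> bool" where
  "local_expectation n d E \<longleftrightarrow>
     (\<forall>f g. (\<forall>x\<in>hcube n. f x = g x) \<longrightarrow> E f = E g) \<and>
     (\<forall>f g. E (\<lambda>x. f x + g x) = E f + E g) \<and>
     (\<forall>a f. E (\<lambda>x. a * f x) = a * E f) \<and>
     E (\<lambda>x. 1) = 1 \<and>
     (\<forall>f\<in>multilinear_polys n d.
        (\<forall>x\<in>hcube n. f x \<ge> 0) \<and> (\<exists>S\<subseteq>{..<n}. card S \<le> d \<and> depends_on n S f)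
        \<longrightarrow> E f \<ge> 0) \<and>
     (\<forall>\<alpha>\<subseteq>{..<n}. card \<alpha> > d \<longrightarrow> E (chi \<alpha>) = 0)"

text \<open>The set of local expectation functionals is compact, so the supremum is a maximum.\<close>

definition SA_value :: "nat \<Rightarrow> nat \<Rightarrow> csp_instance \<Rightarrow> ereal" where
  "SA_value n d I = (SUP E\<in>{E. local_expectation n d E}. ereal (E (csp_val I)))"

definition SA_achieves ::
    "((nat \<Rightarrow> real) \<Rightarrow> real) set \<Rightarrow> nat \<Rightarrow> nat \<Rightarrow> nat \<Rightarrow> real \<Rightarrow> real \<Rightarrow> bool" where
  "SA_achieves Preds k n d c s \<longleftrightarrow>
     (\<forall>I\<in>csp_instances Preds k n. csp_opt n I \<le> s \<longrightarrow> SA_value n d I \<le> ereal c)"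

end

theory Submission
  imports Defs "HOL-Real_Asymp.Real_Asymp"
begin

text \<open>Fix \<open>m\<close>, a hard instance \<open>I\<close> on \<open>m\<close> variables and a \<open>d\<close>-local expectation \<open>E\<close> with
  \<open>E I > c\<close>. For an injection \<open>\<sigma>\<close> of its variables into \<open>{..<n}\<close>, extend \<open>E\<close> to functions of \<open>n\<close>
  variables by averaging over the variables outside the range of \<open>\<sigma>\<close>. Applied to the assignment
  vectors, this gives a point at which the objective of the planted copy of \<open>I\<close> equals \<open>E I\<close>, but
  which may violate the inequalities of the relaxation slightly.

  The slack of an inequality is a nonnegative function \<open>q\<close> on the cube. If its maximum is at most
  \<open>B\<close> times its mean, then its non-negligible Fourier coefficients of degree at most \<open>d\<close> live on a
  set \<open>J\<close> of \<open>O(ln B)\<close> coordinates. As soon as \<open>\<sigma>\<close> hits \<open>J\<close> at most \<open>d\<close> times, the part of \<open>q\<close>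
  on \<open>J\<close> is a nonnegative \<open>d\<close>-junta for \<open>E\<close>, and the violation is a small multiple of the mean.
  With at most \<open>n\<^bsup>d/2\<^esup>\<close> inequalities and \<open>n\<close> large, one \<open>\<sigma>\<close> serves all of them. Mixing in a
  little of the uniform distribution repairs these inequalities. Every other slack is repaired by a
  point mass at its maximum, since that maximum exceeds \<open>B\<close> times the mean. This exhibits a feasible
  point of value more than \<open>c\<close>, so no linear programming duality is needed.\<close>

section \<open>Fourier analysis on the cube\<close>

definition cube_avg :: "nat \<Rightarrow> ((nat \<Rightarrow> real) \<Rightarrow> real) \<Rightarrow> real" where
  "cube_avg n f = (\<Sum>x\<in>hcube n. f x) / 2 ^ n"

definition fourier :: "nat \<Rightarrow> ((nat \<Rightarrow> real) \<Rightarrow> real) \<Rightarrow> nat set \<Rightarrow> real" where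
  "fourier n f \<alpha> = cube_avg n (\<lambda>x. f x * chi \<alpha> x)"

lemma finite_hcube [simp]: "finite (hcube n)"
  unfolding hcube_def by (intro finite_PiE) auto

lemma card_hcube [simp]: "card (hcube n) = 2 ^ n"
  unfolding hcube_def by (simp add: card_PiE numeral_2_eq_2)

lemma hcube_nonempty [simp]: "hcube n \<noteq> {}"
  using card_hcube[of n] by (metis card.empty power_not_zero zero_neq_numeral)

lemma hcube_coord: "x \<in> hcube n \<Longrightarrow> i < n \<Longrightarrow> x i = -1 \<or> x i = 1"
  unfolding hcube_def by (auto dest: PiE_mem)

lemma hcube_coord_sq: "x \<in> hcube n \<Longrightarrow> i < n \<Longrightarrow> x i * x i = 1"
  using hcube_coord[of x n i] by auto

lemma hcube_eqI:
  "x \<in> hcube n \<Longrightarrow> y \<in> hcube n \<Longrightarrow> (\<And>i. i < n \<Longrightarrow> x i = y i) \<Longrightarrow> x = y"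
  unfolding hcube_def by (rule PiE_ext) auto

lemma cube_avg_cong: "(\<And>x. x \<in> hcube n \<Longrightarrow> f x = g x) \<Longrightarrow> cube_avg n f = cube_avg n g"
  unfolding cube_avg_def by (simp cong: sum.cong)

lemma cube_avg_add: "cube_avg n (\<lambda>x. f x + g x) = cube_avg n f + cube_avg n g"
  unfolding cube_avg_def by (simp add: sum.distrib add_divide_distrib)

lemma cube_avg_cmult: "cube_avg n (\<lambda>x. a * f x) = a * cube_avg n f"
  unfolding cube_avg_def by (simp add: sum_distrib_left)

lemma cube_avg_sum: "cube_avg n (\<lambda>x. \<Sum>a\<in>A. g a x) = (\<Sum>a\<in>A. cube_avg n (g a))"
  unfolding cube_avg_def by (subst sum.swap) (simp add: sum_divide_distrib)

lemma cube_avg_const: "cube_avg n (\<lambda>x. a) = a"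
  unfolding cube_avg_def by simp

lemma cube_avg_mono: "(\<And>x. x \<in> hcube n \<Longrightarrow> f x \<le> g x) \<Longrightarrow> cube_avg n f \<le> cube_avg n g"
  unfolding cube_avg_def by (intro divide_right_mono sum_mono) auto

lemma cube_avg_nonneg: "(\<And>x. x \<in> hcube n \<Longrightarrow> 0 \<le> f x) \<Longrightarrow> 0 \<le> cube_avg n f"
  unfolding cube_avg_def by (intro divide_nonneg_nonneg sum_nonneg) auto

lemma chi_empty: "chi {} = (\<lambda>x. 1)"
  by (simp add: chi_def fun_eq_iff)

lemma chi_cases:
  assumes "x \<in> hcube n" "\<alpha> \<subseteq> {..<n}"
  shows "chi \<alpha> x = -1 \<or> chi \<alpha> x = 1"
proof -
  have "finite \<alpha>" using assms(2) finite_subset by blast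
  then show ?thesis using assms(2)
  proof (induction \<alpha>)
    case (insert i \<alpha>)
    then show ?case using hcube_coord[OF assms(1), of i] by (auto simp: chi_def)
  qed (simp add: chi_def)
qed

lemma flip_in_hcube: "x \<in> hcube n \<Longrightarrow> i < n \<Longrightarrow> x(i := - x i) \<in> hcube n"
  using hcube_coord[of x n i] unfolding hcube_def by (fastforce simp: PiE_iff extensional_def)

lemma cube_avg_flip:
  assumes "i < n"
  shows "cube_avg n (\<lambda>x. f (x(i := - x i))) = cube_avg n f"
proof -
  have "(\<Sum>x\<in>hcube n. f (x(i := - x i))) = (\<Sum>x\<in>hcube n. f x)"
    by (rule sum.reindex_bij_witness[where i="\<lambda>x. x(i := - x i)" and j="\<lambda>x. x(i := - x i)"])
      (auto simp: flip_in_hcube assms)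
  then show ?thesis by (simp add: cube_avg_def)
qed

lemma chi_flip:
  assumes "finite \<alpha>"
  shows "chi \<alpha> (x(i := - x i)) = (if i \<in> \<alpha> then - chi \<alpha> x else chi \<alpha> x)"
proof (cases "i \<in> \<alpha>")
  case True
  have "chi \<alpha> y = y i * (\<Prod>j\<in>\<alpha> - {i}. y j)" for y
    unfolding chi_def using prod.remove[OF assms True] by blast
  from this[of x] this[of "x(i := - x i)"] show ?thesis using True by simp
next
  case False
  then show ?thesis unfolding chi_def by (auto intro!: prod.cong)
qed

text \<open>Flipping a coordinate in \<open>\<alpha>\<close> preserves the uniform distribution and
  negates the character, so for nonempty \<open>\<alpha>\<close> the mean equals its own
  negative.\<close>

lemma cube_avg_chi:
  assumes "\<alpha> \<subseteq> {..<n}"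
  shows "cube_avg n (chi \<alpha>) = (if \<alpha> = {} then 1 else 0)"
proof (cases "\<alpha> = {}")
  case True
  then show ?thesis by (simp add: chi_empty cube_avg_const)
next
  case False
  then obtain i where i: "i \<in> \<alpha>" by auto
  have fin: "finite \<alpha>" using assms finite_subset by blast
  have "cube_avg n (chi \<alpha>) = cube_avg n (\<lambda>x. chi \<alpha> (x(i := - x i)))"
    using cube_avg_flip[of i n "chi \<alpha>"] i assms by auto
  also have "\<dots> = cube_avg n (\<lambda>x. (-1) * chi \<alpha> x)"
    using i by (intro cube_avg_cong) (simp add: chi_flip fin)
  also have "\<dots> = - cube_avg n (chi \<alpha>)" by (subst cube_avg_cmult) simp
  finally show ?thesis using False by simp
qed

lemma sum_Pow_chi_mult:
  assumes "finite T"
  shows "(\<Sum>\<beta>\<in>Pow T. chi \<beta> x * chi \<beta> z) = (\<Prod>i\<in>T. 1 + x i * z i)"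
proof -
  have "(\<Prod>i\<in>T. 1 + x i * z i) = (\<Prod>i\<in>T. x i * z i + 1)" by (simp add: add.commute)
  also have "\<dots> = (\<Sum>\<beta>\<in>Pow T. (\<Prod>i\<in>\<beta>. x i * z i) * (\<Prod>i\<in>T - \<beta>. 1))"
    using assms by (rule prod_add)
  finally show ?thesis by (simp add: chi_def prod.distrib)
qed

text \<open>Summed over all \<open>\<beta>\<close>, the products
  \<open>chi \<beta> x * chi \<beta> z\<close> factor into \<open>\<Prod>i<n. 1 + x i * z i\<close>,
  which is \<open>2 ^ n\<close> at \<open>x = z\<close> and has a zero factor at every other point
  of the cube.\<close>

lemma fourier_inversion:
  assumes z: "z \<in> hcube n"
  shows "g z = (\<Sum>\<beta>\<in>Pow {..<n}. fourier n g \<beta> * chi \<beta> z)"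
proof -
  have delta: "(\<Prod>i<n. 1 + x i * z i) = (if x = z then 2 ^ n else 0)" if x: "x \<in> hcube n" for x
  proof (cases "x = z")
    case True
    then show ?thesis using hcube_coord_sq[OF z] by simp
  next
    case False
    then obtain i where i: "i < n" "x i \<noteq> z i" using hcube_eqI x z by blast
    then have "1 + x i * z i = 0" using hcube_coord[OF x i(1)] hcube_coord[OF z i(1)] by auto
    then have "(\<Prod>i<n. 1 + x i * z i) = 0" using i(1) by (intro prod_zero) auto
    then show ?thesis using False by simp
  qed
  have "(\<Sum>\<beta>\<in>Pow {..<n}. fourier n g \<beta> * chi \<beta> z)
      = (\<Sum>\<beta>\<in>Pow {..<n}. cube_avg n (\<lambda>x. g x * (chi \<beta> x * chi \<beta> z)))"
    unfolding fourier_def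
    by (intro sum.cong refl) (simp add: cube_avg_def sum_distrib_right mult.assoc)
  also have "\<dots> = cube_avg n (\<lambda>x. \<Sum>\<beta>\<in>Pow {..<n}. g x * (chi \<beta> x * chi \<beta> z))"
    by (rule cube_avg_sum[symmetric])
  also have "\<dots> = cube_avg n (\<lambda>x. g x * (\<Prod>i<n. 1 + x i * z i))"
    by (simp add: sum_Pow_chi_mult[symmetric] sum_distrib_left)
  also have "\<dots> = cube_avg n (\<lambda>x. if x = z then 2 ^ n * g x else 0)"
    by (rule cube_avg_cong) (simp add: delta)
  also have "\<dots> = g z"
    unfolding cube_avg_def using z by simp
  finally show ?thesis by simp
qed

lemma abs_fourier_le:
  assumes "\<And>x. x \<in> hcube n \<Longrightarrow> 0 \<le> f x" "\<alpha> \<subseteq> {..<n}"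
  shows "\<bar>fourier n f \<alpha>\<bar> \<le> cube_avg n f"
proof -
  have "\<bar>f x * chi \<alpha> x\<bar> \<le> f x" if "x \<in> hcube n" for x
    using chi_cases[OF that assms(2)] assms(1)[OF that] by auto
  then have *: "f x * chi \<alpha> x \<le> f x" "(-1) * f x \<le> f x * chi \<alpha> x" if "x \<in> hcube n" for x
    using that by (fastforce simp: abs_le_iff)+
  have "fourier n f \<alpha> \<le> cube_avg n f"
    unfolding fourier_def using * by (intro cube_avg_mono) auto
  moreover have "cube_avg n (\<lambda>x. (-1) * f x) \<le> fourier n f \<alpha>"
    unfolding fourier_def using * by (intro cube_avg_mono) auto
  ultimately show ?thesis by (subst (asm) cube_avg_cmult) (simp add: abs_le_iff)
qed

section \<open>Pulling assignments back along an injection of variables\<close>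

definition pull :: "nat \<Rightarrow> (nat \<Rightarrow> nat) \<Rightarrow> (nat \<Rightarrow> real) \<Rightarrow> nat \<Rightarrow> real" where
  "pull m \<sigma> x = (\<lambda>j\<in>{..<m}. x (\<sigma> j))"

lemma pull_in_hcube:
  assumes "\<sigma> ` {..<m} \<subseteq> {..<n}" "x \<in> hcube n"
  shows "pull m \<sigma> x \<in> hcube m"
  unfolding hcube_def pull_def
  using assms hcube_coord[OF assms(2)] by (intro restrict_PiE_iff[THEN iffD2]) blast

lemma chi_pull:
  assumes "inj_on \<sigma> {..<m}" "\<beta> \<subseteq> {..<m}"
  shows "chi \<beta> (pull m \<sigma> x) = chi (\<sigma> ` \<beta>) x"
proof -
  have "inj_on \<sigma> \<beta>" using assms inj_on_subset by blast
  then show ?thesis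
    using assms(2) unfolding chi_def pull_def by (subst prod.reindex) (auto intro!: prod.cong)
qed

text \<open>An injection of variables carries the uniform distribution on the larger cube to the
  uniform one on the smaller: after expanding \<open>h\<close> in characters, each nonempty
  \<open>\<beta>\<close> has a nonempty image, whose character has mean 0.\<close>

lemma cube_avg_pull:
  assumes "inj_on \<sigma> {..<m}" "\<sigma> ` {..<m} \<subseteq> {..<n}"
  shows "cube_avg n (\<lambda>x. h (pull m \<sigma> x)) = cube_avg m h"
proof -
  have "cube_avg n (\<lambda>x. h (pull m \<sigma> x))
      = cube_avg n (\<lambda>x. \<Sum>\<beta>\<in>Pow {..<m}. fourier m h \<beta> * chi (\<sigma> ` \<beta>) x)"
    using fourier_inversion[OF pull_in_hcube[OF assms(2)], of _ h]
    by (intro cube_avg_cong) (auto simp: chi_pull[OF assms(1)] intro!: sum.cong)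
  also have "\<dots> = (\<Sum>\<beta>\<in>Pow {..<m}. fourier m h \<beta> * cube_avg n (chi (\<sigma> ` \<beta>)))"
    by (simp add: cube_avg_sum cube_avg_cmult)
  also have "\<dots> = (\<Sum>\<beta>\<in>Pow {..<m}. if \<beta> = {} then fourier m h \<beta> else 0)"
  proof (intro sum.cong refl)
    fix \<beta> assume "\<beta> \<in> Pow {..<m}"
    then have "\<sigma> ` \<beta> \<subseteq> {..<n}" using assms(2) by blast
    then show "fourier m h \<beta> * cube_avg n (chi (\<sigma> ` \<beta>)) = (if \<beta> = {} then fourier m h \<beta> else 0)"
      by (simp add: cube_avg_chi)
  qed
  also have "\<dots> = cube_avg m h" by (simp add: fourier_def chi_empty)
  finally show ?thesis .
qed

lemma fourier_pull:
  assumes "inj_on \<sigma> {..<m}" "\<sigma> ` {..<m} \<subseteq> {..<n}" "\<beta> \<subseteq> {..<m}"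
  shows "fourier n (\<lambda>x. g (pull m \<sigma> x)) (\<sigma> ` \<beta>) = fourier m g \<beta>"
  unfolding fourier_def chi_pull[OF assms(1,3), symmetric]
  using cube_avg_pull[OF assms(1,2), of "\<lambda>z. g z * chi \<beta> z"] by simp

section \<open>Bounding the number of coordinates carrying large low-degree coefficients\<close>

text \<open>The characters of a triangular list are independent fair signs under the uniform
  distribution.\<close>

primrec triangular :: "nat set list \<Rightarrow> bool" where
  "triangular [] \<longleftrightarrow> True"
| "triangular (a # as) \<longleftrightarrow> \<not> a \<subseteq> \<Union>(set as) \<and> triangular as"

text \<open>This bounds the moment generating function of a fair sign. The estimate for
  \<open>exp (- t)\<close> comes from \<open>(1 + t) * (1 - t + t\<^sup>2) = 1 + t ^ 3\<close>,
  which is at least 1, together with \<open>1 + t \<le> exp t\<close>.\<close>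

lemma cosh_bound:
  fixes t :: real
  assumes "0 \<le> t" "t \<le> 1"
  shows "(exp t + exp (- t)) / 2 \<le> exp (t\<^sup>2)"
proof -
  have "exp t \<le> 1 + t + t\<^sup>2" using exp_bound assms by simp
  moreover have "exp (- t) \<le> 1 - t + t\<^sup>2"
  proof -
    have "1 \<le> (1 + t) * (1 - t + t\<^sup>2)"
      using assms by (simp add: algebra_simps power2_eq_square)
    also have "\<dots> \<le> exp t * (1 - t + t\<^sup>2)"
      using assms by (intro mult_right_mono) auto
    finally show ?thesis by (simp add: exp_minus field_simps)
  qed
  ultimately have "(exp t + exp (- t)) / 2 \<le> ((1 + t + t\<^sup>2) + (1 - t + t\<^sup>2)) / 2"
    by (intro divide_right_mono add_mono) auto
  also have "\<dots> = 1 + t\<^sup>2" by simp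
  also have "\<dots> \<le> exp (t\<^sup>2)" by (rule exp_ge_add_one_self)
  finally show ?thesis .
qed

text \<open>The head contains a coordinate \<open>i\<close> that no later set contains. Averaging
  over \<open>x\<close> and its flip at \<open>i\<close> turns the factor of the head into the
  hyperbolic cosine of \<open>t\<close> and leaves the other factors unchanged, so each entry costs
  one factor \<open>exp (t\<^sup>2)\<close>.\<close>

lemma cube_avg_exp_triangular:
  assumes "triangular as" "\<forall>a\<in>set as. a \<subseteq> {..<n} \<and> \<bar>e a\<bar> = 1" "0 \<le> t" "t \<le> 1"
  shows "cube_avg n (\<lambda>x. exp (\<Sum>a\<leftarrow>as. t * e a * chi a x)) \<le> exp (real (length as) * t\<^sup>2)"
  using assms(1,2)
proof (induction as)
  case Nil
  then show ?case by (simp add: cube_avg_const)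
next
  case (Cons a as)
  from Cons.prems(1) obtain i where i: "i \<in> a" "i \<notin> \<Union>(set as)" by (auto simp: subset_eq)
  have a: "a \<subseteq> {..<n}" "\<bar>e a\<bar> = 1" using Cons.prems by auto
  have fin: "finite b" if "b \<in> set (a # as)" for b
    using Cons.prems(2) that finite_subset by blast
  define G where "G x = exp (\<Sum>a\<leftarrow>as. t * e a * chi a x)" for x
  have G: "G (x(i := - x i)) = G x" for x
  proof -
    have "map (\<lambda>a. t * e a * chi a (x(i := - x i))) as = map (\<lambda>a. t * e a * chi a x) as"
      using i fin by (auto simp: chi_flip)
    then show ?thesis
      unfolding G_def by (rule arg_cong[of _ _ "\<lambda>ys. exp (sum_list ys)"])
  qed
  let ?c = "(exp t + exp (- t)) / 2"
  have "cube_avg n (\<lambda>x. exp (\<Sum>a\<leftarrow>a # as. t * e a * chi a x))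
      = cube_avg n (\<lambda>x. exp (t * e a * chi a x) * G x)"
    by (simp add: G_def exp_add)
  also have "\<dots> = (cube_avg n (\<lambda>x. exp (t * e a * chi a x) * G x) +
       cube_avg n (\<lambda>x. exp (t * e a * chi a (x(i := - x i))) * G (x(i := - x i)))) / 2"
    using cube_avg_flip[of i n "\<lambda>x. exp (t * e a * chi a x) * G x"] i a by auto
  also have "\<dots> = cube_avg n (\<lambda>x. ?c * G x)"
  proof -
    have "exp (t * e a * chi a x) * G x + exp (t * e a * chi a (x(i := - x i))) * G (x(i := - x i))
      = 2 * (?c * G x)" if x: "x \<in> hcube n" for x
    proof -
      have "e a * chi a x = 1 \<or> e a * chi a x = -1"
        using chi_cases[OF x a(1)] a(2) by (auto simp: abs_if split: if_splits)
      moreover have "chi a (x(i := - x i)) = - chi a x"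
        using i fin by (simp add: chi_flip)
      ultimately show ?thesis
        using G[of x] by (auto simp: mult.assoc algebra_simps)
    qed
    then have "cube_avg n (\<lambda>x. exp (t * e a * chi a x) * G x +
        exp (t * e a * chi a (x(i := - x i))) * G (x(i := - x i))) = cube_avg n (\<lambda>x. 2 * (?c * G x))"
      by (rule cube_avg_cong)
    then show ?thesis unfolding cube_avg_add cube_avg_cmult[of n 2] by simp
  qed
  also have "\<dots> = ?c * cube_avg n G" by (rule cube_avg_cmult)
  also have "\<dots> \<le> exp (t\<^sup>2) * exp (real (length as) * t\<^sup>2)"
    using Cons cosh_bound[OF assms(3,4)] unfolding G_def
    by (intro mult_mono cube_avg_nonneg) auto
  finally show ?case by (simp add: exp_add[symmetric] algebra_simps)
qed

text \<open>Under the density \<open>f / F\<close> the variable \<open>Y\<close> has mean at least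
  \<open>M\<close>, so by convexity \<open>exp Y\<close> has mean at least \<open>exp M\<close>. As
  the density is at most \<open>B\<close>, that mean is at most \<open>B\<close> times the uniform
  mean of \<open>exp Y\<close>, which is small for a triangular list.\<close>

lemma triangular_length_bound:
  assumes tri: "triangular as"
    and large: "\<forall>a\<in>set as. a \<subseteq> {..<n} \<and> \<gamma> * cube_avg n f < \<bar>fourier n f a\<bar>"
    and f: "\<And>x. x \<in> hcube n \<Longrightarrow> 0 \<le> f x" "\<And>x. x \<in> hcube n \<Longrightarrow> f x \<le> B * cube_avg n f"
    and pos: "0 < cube_avg n f" and \<gamma>: "0 < \<gamma>" "\<gamma> \<le> 1" and B: "1 \<le> B"
  shows "real (length as) * \<gamma>\<^sup>2 / 4 \<le> ln B"
proof -
  define F where "F = cube_avg n f"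
  \<comment> \<open>The value \<open>\<gamma> / 2\<close> maximises
    \<open>t * \<gamma> - t\<^sup>2\<close>, the gain per list entry in the final inequality
    \<open>M \<le> ln B + real (length as) * t\<^sup>2\<close>.\<close>
  define t where "t = \<gamma> / 2"
  define e where "e a = (if fourier n f a \<ge> 0 then 1 else -1 :: real)" for a
  define Y where "Y x = (\<Sum>a\<leftarrow>as. t * e a * chi a x)" for x
  define M where "M = t * real (length as) * \<gamma>"
  have t: "0 \<le> t" "t \<le> 1" using \<gamma> by (auto simp: t_def)
  have F: "F > 0" using pos F_def by simp
  have avg_fY: "cube_avg n (\<lambda>x. f x * Y x) = (\<Sum>a\<leftarrow>as. t * \<bar>fourier n f a\<bar>)"
    unfolding Y_def
  proof (induction as)
    case Nil
    then show ?case by (simp add: cube_avg_const)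
  next
    case (Cons a as)
    have "cube_avg n (\<lambda>x. f x * (\<Sum>a\<leftarrow>a # as. t * e a * chi a x))
        = cube_avg n (\<lambda>x. (t * e a) * (f x * chi a x) + f x * (\<Sum>a\<leftarrow>as. t * e a * chi a x))"
      by (simp add: algebra_simps)
    also have "\<dots> = t * (e a * fourier n f a) + (\<Sum>a\<leftarrow>as. t * \<bar>fourier n f a\<bar>)"
      by (simp add: cube_avg_add cube_avg_cmult Cons.IH fourier_def)
    also have "e a * fourier n f a = \<bar>fourier n f a\<bar>" by (simp add: e_def)
    finally show ?case by simp
  qed
  have "M * F = (\<Sum>a\<leftarrow>as. t * (\<gamma> * F))"
    by (simp add: M_def sum_list_triv)
  also have "\<dots> \<le> cube_avg n (\<lambda>x. f x * Y x)"
    unfolding avg_fY using large t(1)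
    by (intro sum_list_mono mult_left_mono) (auto simp: F_def)
  finally have MF: "M * F \<le> cube_avg n (\<lambda>x. f x * Y x)" .
  \<comment> \<open>Jensen's inequality for the density \<open>f / F\<close>, through the tangent of \<open>exp\<close> at \<open>M\<close>\<close>
  have tangent: "exp M * (1 + (y - M)) \<le> exp y" for y
  proof -
    have "exp M * (1 + (y - M)) \<le> exp M * exp (y - M)"
      by (intro mult_left_mono exp_ge_add_one_self) auto
    then show ?thesis by (simp add: exp_add[symmetric])
  qed
  have "exp M * F \<le> exp M * (F + (cube_avg n (\<lambda>x. f x * Y x) - M * F))"
    using MF by (intro mult_left_mono) auto
  also have "\<dots> = cube_avg n (\<lambda>x. exp M * (f x + (f x * Y x + (- M) * f x)))"
    unfolding cube_avg_cmult cube_avg_add F_def by simp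
  also have "\<dots> = cube_avg n (\<lambda>x. f x * (exp M * (1 + (Y x - M))))"
    by (simp add: algebra_simps)
  also have "\<dots> \<le> cube_avg n (\<lambda>x. (B * F) * exp (Y x))"
    using f tangent unfolding F_def[symmetric]
    by (intro cube_avg_mono order_trans[OF mult_left_mono[OF tangent] mult_right_mono]) auto
  also have "\<dots> = (B * F) * cube_avg n (\<lambda>x. exp (Y x))" by (rule cube_avg_cmult)
  also have "\<dots> \<le> (B * F) * exp (real (length as) * t\<^sup>2)"
    unfolding Y_def using B F tri large t
    by (intro mult_left_mono cube_avg_exp_triangular) (auto simp: e_def)
  finally have "exp M \<le> B * exp (real (length as) * t\<^sup>2)"
    using F by (simp add: mult.assoc mult.commute[of _ F])
  then have "ln (exp M) \<le> ln (B * exp (real (length as) * t\<^sup>2))"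
    using B by (subst ln_le_cancel_iff) auto
  then have "M \<le> ln B + real (length as) * t\<^sup>2"
    using B by (simp add: ln_mult)
  then show ?thesis by (simp add: M_def t_def power2_eq_square field_simps)
qed

text \<open>Take a longest triangular list of sets of size at most \<open>d\<close> with large
  coefficients, and let \<open>J\<close> be its union. A further such set not inside
  \<open>J\<close> could be put in front of the list, contradicting maximality. The length bound
  makes a longest list exist and controls \<open>card J\<close>.\<close>

lemma junta_cover:
  assumes f: "\<And>x. x \<in> hcube n \<Longrightarrow> 0 \<le> f x" "\<And>x. x \<in> hcube n \<Longrightarrow> f x \<le> B * cube_avg n f"
    and \<gamma>: "0 < \<gamma>" "\<gamma> \<le> 1" and B: "1 \<le> B"
  obtains J where "J \<subseteq> {..<n}" "real (card J) \<le> real d * 4 * ln B / \<gamma>\<^sup>2"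
    "\<And>\<alpha>. \<alpha> \<subseteq> {..<n} \<Longrightarrow> card \<alpha> \<le> d \<Longrightarrow> \<not> \<alpha> \<subseteq> J \<Longrightarrow> \<bar>fourier n f \<alpha>\<bar> \<le> \<gamma> * cube_avg n f"
proof (cases "cube_avg n f = 0")
  \<comment> \<open>With mean 0 all coefficients vanish, so the empty set is a cover; the length
    bound is available only for a positive mean.\<close>
  case True
  then have "\<bar>fourier n f \<alpha>\<bar> \<le> \<gamma> * cube_avg n f" if "\<alpha> \<subseteq> {..<n}" for \<alpha>
    using abs_fourier_le[where f = f, OF f(1) that] True by simp
  moreover have "0 \<le> ln B" using B by simp
  ultimately show ?thesis using that[of "{}"] by simp
next
  case False
  then have pos: "0 < cube_avg n f" using cube_avg_nonneg[of n f] f(1) by fastforce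
  define Q where "Q as \<longleftrightarrow> triangular as \<and>
    (\<forall>a\<in>set as. a \<subseteq> {..<n} \<and> card a \<le> d \<and> \<gamma> * cube_avg n f < \<bar>fourier n f a\<bar>)" for as
  have len: "real (length as) \<le> 4 * ln B / \<gamma>\<^sup>2" if "Q as" for as
  proof -
    have "real (length as) * \<gamma>\<^sup>2 / 4 \<le> ln B"
      using that by (intro triangular_length_bound[OF _ _ f pos \<gamma> B]) (auto simp: Q_def)
    then show ?thesis using \<gamma> by (simp add: field_simps)
  qed
  have "\<forall>as. Q as \<longrightarrow> length as < Suc (nat \<lfloor>4 * ln B / \<gamma>\<^sup>2\<rfloor>)"
    using len by (auto simp: less_Suc_eq_le intro: le_nat_floor)
  moreover have "Q []" by (simp add: Q_def)
  ultimately obtain as where as: "Q as" "\<And>bs. Q bs \<Longrightarrow> length bs \<le> length as"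
    using ex_has_greatest_nat[of Q "[]" length] by blast
  show ?thesis
  proof (rule that[of "\<Union>(set as)"])
    show "\<Union>(set as) \<subseteq> {..<n}" using as(1) by (auto simp: Q_def)
    have "card (\<Union>(set as)) \<le> sum card (set as)" by (rule card_Union_le_sum_card)
    also have "\<dots> \<le> card (set as) * d"
      using as(1) sum_bounded_above[of "set as" card d] by (auto simp: Q_def)
    also have "\<dots> \<le> length as * d" by (simp add: card_length)
    finally have "real (card (\<Union>(set as))) \<le> real (length as) * real d"
      by (metis of_nat_le_iff of_nat_mult)
    also have "\<dots> \<le> (4 * ln B / \<gamma>\<^sup>2) * real d"
      using len[OF as(1)] by (intro mult_right_mono) auto
    finally show "real (card (\<Union>(set as))) \<le> real d * 4 * ln B / \<gamma>\<^sup>2"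
      by (simp add: mult_ac)
  next
    fix \<alpha> assume \<alpha>: "\<alpha> \<subseteq> {..<n}" "card \<alpha> \<le> d" "\<not> \<alpha> \<subseteq> \<Union>(set as)"
    show "\<bar>fourier n f \<alpha>\<bar> \<le> \<gamma> * cube_avg n f"
    proof (rule ccontr)
      assume "\<not> ?thesis"
      then have "Q (\<alpha> # as)" using \<alpha> as(1) by (auto simp: Q_def)
      then show False using as(2) by fastforce
    qed
  qed
qed

section \<open>Local expectation functionals\<close>

lemma local_expectation_cong:
  assumes "local_expectation n d E" "\<And>x. x \<in> hcube n \<Longrightarrow> f x = g x"
  shows "E f = E g"
proof -
  have "\<forall>f g. (\<forall>x\<in>hcube n. f x = g x) \<longrightarrow> E f = E g"
    using assms(1) unfolding local_expectation_def by (rule conjunct1)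
  from this[rule_format, of f g] show ?thesis using assms(2) by simp
qed

lemma local_expectation_sum:
  assumes E: "local_expectation n d E" and "finite A"
  shows "E (\<lambda>x. \<Sum>a\<in>A. p a * g a x) = (\<Sum>a\<in>A. p a * E (g a))"
  using assms(2)
proof (induction A)
  case empty
  have "\<forall>a f. E (\<lambda>x. a * f x) = a * E f"
    using E by (simp add: local_expectation_def)
  from this[rule_format, of 0 "\<lambda>x. 0"] show ?case by simp
next
  case (insert a A)
  have add: "\<forall>f g. E (\<lambda>x. f x + g x) = E f + E g" and cmult: "\<forall>a f. E (\<lambda>x. a * f x) = a * E f"
    using E by (simp_all add: local_expectation_def)
  have "E (\<lambda>x. p a * g a x + (\<Sum>a\<in>A. p a * g a x)) = p a * E (g a) + E (\<lambda>x. \<Sum>a\<in>A. p a * g a x)"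
    using add[rule_format, of "\<lambda>x. p a * g a x" "\<lambda>x. \<Sum>a\<in>A. p a * g a x"] cmult by simp
  then show ?case using insert by simp
qed

text \<open>This form of the nonnegativity condition leaves \<open>p\<close> free: in the lift it
  holds Fourier coefficients of a function of \<open>n\<close> variables, while the characters live
  on \<open>m\<close> variables.\<close>

lemma local_expectation_junta_nonneg:
  assumes E: "local_expectation m d E" and T: "T \<subseteq> {..<m}" "card T \<le> d"
    and nonneg: "\<And>z. z \<in> hcube m \<Longrightarrow> 0 \<le> (\<Sum>\<beta>\<in>Pow T. p \<beta> * chi \<beta> z)"
  shows "0 \<le> (\<Sum>\<beta>\<in>Pow T. p \<beta> * E (chi \<beta>))"
proof -
  have fin: "finite T" using T(1) finite_subset by blast
  define h where "h = (\<lambda>z. \<Sum>\<beta>\<in>Pow T. p \<beta> * chi \<beta> z)"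
  have h: "h x = (\<Sum>\<alpha> | \<alpha> \<subseteq> {..<m} \<and> card \<alpha> \<le> d. (if \<alpha> \<subseteq> T then p \<alpha> else 0) * chi \<alpha> x)" for x
    unfolding h_def
  proof (rule sum.mono_neutral_cong_left)
    show "finite {\<alpha>. \<alpha> \<subseteq> {..<m} \<and> card \<alpha> \<le> d}" by simp
    show "Pow T \<subseteq> {\<alpha>. \<alpha> \<subseteq> {..<m} \<and> card \<alpha> \<le> d}"
      using T card_mono[OF fin] by (auto intro: order_trans)
  qed auto
  have "h \<in> multilinear_polys m d"
    unfolding multilinear_polys_def
    by (intro CollectI exI[of _ "\<lambda>\<alpha>. if \<alpha> \<subseteq> T then p \<alpha> else 0"] ballI) (rule h)
  moreover have "depends_on m T h"
    unfolding depends_on_def h_def chi_def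
    by (auto intro!: sum.cong prod.cong arg_cong[of _ _ "\<lambda>r. p _ * r"])
  moreover have "\<forall>z\<in>hcube m. 0 \<le> h z" using nonneg h_def by simp
  ultimately have "0 \<le> E h"
    using E T unfolding local_expectation_def by blast
  also have "E h = (\<Sum>\<beta>\<in>Pow T. p \<beta> * E (chi \<beta>))"
    unfolding h_def by (rule local_expectation_sum[OF E]) (simp add: fin)
  finally show ?thesis .
qed

text \<open>Up to degree \<open>d\<close>, both \<open>1 + chi \<beta>\<close> and
  \<open>1 - chi \<beta>\<close> are nonnegative and depend only on the variables in
  \<open>\<beta>\<close>; above degree \<open>d\<close> the value is 0.\<close>

lemma local_expectation_chi_bound:
  assumes E: "local_expectation m d E" and \<beta>: "\<beta> \<subseteq> {..<m}"
  shows "\<bar>E (chi \<beta>)\<bar> \<le> 1"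
proof -
  have E1: "E (chi {}) = 1" using E by (simp add: local_expectation_def chi_empty)
  consider "\<beta> = {}" | "card \<beta> > d" | "\<beta> \<noteq> {}" "card \<beta> \<le> d" by linarith
  then show ?thesis
  proof cases
    case 2
    then show ?thesis using E \<beta> by (simp add: local_expectation_def)
  next
    case 3
    have fin: "finite \<beta>" using \<beta> finite_subset by blast
    \<comment> \<open>These are the coefficients of \<open>1 + e * chi \<beta>\<close> over
      \<open>Pow \<beta>\<close>. With \<open>g\<close> general, the identity serves both for the
      values \<open>chi \<alpha> z\<close> and for the expectations
      \<open>E (chi \<alpha>)\<close>.\<close>
    have *: "(\<Sum>\<alpha>\<in>Pow \<beta>. (if \<alpha> = {} then 1 else if \<alpha> = \<beta> then e else 0) * g \<alpha>) = g {} + e * g \<beta>"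
      for e :: real and g :: "nat set \<Rightarrow> real"
    proof -
      have "(\<Sum>\<alpha>\<in>Pow \<beta>. (if \<alpha> = {} then 1 else if \<alpha> = \<beta> then e else 0) * g \<alpha>)
        = (\<Sum>\<alpha>\<in>{{}, \<beta>}. (if \<alpha> = {} then 1 else if \<alpha> = \<beta> then e else 0) * g \<alpha>)"
        using fin by (intro sum.mono_neutral_right) auto
      then show ?thesis using 3 by simp
    qed
    have "0 \<le> E (chi {}) + e * E (chi \<beta>)" if e: "\<bar>e\<bar> = 1" for e
      unfolding *[of e "\<lambda>\<alpha>. E (chi \<alpha>)", symmetric]
    proof (rule local_expectation_junta_nonneg[OF E \<beta> 3(2)])
      fix z assume "z \<in> hcube m"
      then show "0 \<le> (\<Sum>\<alpha>\<in>Pow \<beta>. (if \<alpha> = {} then 1 else if \<alpha> = \<beta> then e else 0) * chi \<alpha> z)"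
        unfolding * using chi_cases[OF _ \<beta>, of z] e by (auto simp: chi_empty)
    qed
    from this[of 1] this[of "-1"] show ?thesis using E1 by auto
  qed (simp add: E1)
qed

section \<open>Lifting a local expectation to more variables\<close>

text \<open>The sum is over all \<open>\<beta> \<subseteq> {..<m}\<close>; characters involving a variable outside the range of
  \<open>\<sigma>\<close> are sent to \<open>0\<close>.\<close>

definition lift_expect ::
    "nat \<Rightarrow> nat \<Rightarrow> (nat \<Rightarrow> nat) \<Rightarrow> (((nat \<Rightarrow> real) \<Rightarrow> real) \<Rightarrow> real) \<Rightarrow> ((nat \<Rightarrow> real) \<Rightarrow> real) \<Rightarrow> real" where
  "lift_expect m n \<sigma> E f = (\<Sum>\<beta>\<in>Pow {..<m}. fourier n f (\<sigma> ` \<beta>) * E (chi \<beta>))"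

text \<open>Because \<open>w\<close> does not depend on \<open>f\<close>, the lift can be applied
  coordinatewise to the assignment vectors. The weights may be negative, so this gives a signed
  combination rather than a convex one.\<close>

lemma lift_expect_eq_sum:
  obtains w where "\<And>f. lift_expect m n \<sigma> E f = (\<Sum>x\<in>hcube n. w x * f x)"
proof
  fix f
  show "lift_expect m n \<sigma> E f
      = (\<Sum>x\<in>hcube n. (\<Sum>\<beta>\<in>Pow {..<m}. chi (\<sigma> ` \<beta>) x * E (chi \<beta>) / 2 ^ n) * f x)"
    unfolding lift_expect_def fourier_def cube_avg_def sum_distrib_right sum_divide_distrib
    by (subst sum.swap) (simp add: mult_ac)
qed

text \<open>The planted objective is a pulled-back function. Its coefficient at the image of
  \<open>\<beta>\<close> is the coefficient of \<open>g\<close> at \<open>\<beta>\<close>, so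
  Fourier inversion on \<open>m\<close> variables returns \<open>E g\<close>.\<close>

lemma lift_expect_pull:
  assumes E: "local_expectation m d E" and "inj_on \<sigma> {..<m}" "\<sigma> ` {..<m} \<subseteq> {..<n}"
  shows "lift_expect m n \<sigma> E (\<lambda>x. g (pull m \<sigma> x)) = E g"
proof -
  have "lift_expect m n \<sigma> E (\<lambda>x. g (pull m \<sigma> x)) = (\<Sum>\<beta>\<in>Pow {..<m}. fourier m g \<beta> * E (chi \<beta>))"
    unfolding lift_expect_def by (intro sum.cong) (simp_all add: fourier_pull[OF assms(2,3)])
  also have "\<dots> = E (\<lambda>z. \<Sum>\<beta>\<in>Pow {..<m}. fourier m g \<beta> * chi \<beta> z)"
    by (rule local_expectation_sum[OF E, symmetric]) simp
  also have "\<dots> = E g"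
    using fourier_inversion[of _ m g] by (intro local_expectation_cong[OF E]) simp
  finally show ?thesis .
qed

text \<open>Each of the \<open>2 ^ m\<close> summands is at least minus the mean of
  \<open>f\<close>. This crude bound serves the slacks with a sharp peak, for which no small cover
  is at hand.\<close>

lemma lift_expect_ge:
  assumes E: "local_expectation m d E" and \<sigma>: "\<sigma> ` {..<m} \<subseteq> {..<n}"
    and f: "\<And>x. x \<in> hcube n \<Longrightarrow> 0 \<le> f x"
  shows "- (2 ^ m) * cube_avg n f \<le> lift_expect m n \<sigma> E f"
proof -
  have "- (2 ^ m) * cube_avg n f = (\<Sum>\<beta>\<in>Pow {..<m}. - cube_avg n f)"
    by (simp add: card_Pow)
  also have "\<dots> \<le> lift_expect m n \<sigma> E f"
    unfolding lift_expect_def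
  proof (rule sum_mono)
    fix \<beta> assume \<beta>: "\<beta> \<in> Pow {..<m}"
    then have "\<bar>fourier n f (\<sigma> ` \<beta>)\<bar> \<le> cube_avg n f"
      using \<sigma> f by (intro abs_fourier_le) auto
    then have "\<bar>fourier n f (\<sigma> ` \<beta>)\<bar> * \<bar>E (chi \<beta>)\<bar> \<le> cube_avg n f * 1"
      using local_expectation_chi_bound[OF E] \<beta> by (intro mult_mono) auto
    then show "- cube_avg n f \<le> fourier n f (\<sigma> ` \<beta>) * E (chi \<beta>)"
      by (simp add: abs_mult[symmetric] abs_le_iff)
  qed
  finally show ?thesis .
qed

text \<open>Let \<open>T\<close> collect the variables that \<open>\<sigma>\<close> sends into
  \<open>J\<close>. The summands with \<open>\<beta> \<subseteq> T\<close> together are the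
  expectation of a nonnegative function of at most \<open>d\<close> variables. Every other summand
  has a small coefficient or a degree above \<open>d\<close>, where \<open>E\<close>
  vanishes.\<close>

lemma lift_expect_junta_ge:
  assumes E: "local_expectation m d E" and inj: "inj_on \<sigma> {..<m}" and \<sigma>: "\<sigma> ` {..<m} \<subseteq> {..<n}"
    and f: "\<And>x. x \<in> hcube n \<Longrightarrow> 0 \<le> f x" and \<gamma>: "0 \<le> \<gamma>"
    and J: "card {j. j < m \<and> \<sigma> j \<in> J} \<le> d"
    and small: "\<And>\<alpha>. \<alpha> \<subseteq> {..<n} \<Longrightarrow> card \<alpha> \<le> d \<Longrightarrow> \<not> \<alpha> \<subseteq> J \<Longrightarrow>
      \<bar>fourier n f \<alpha>\<bar> \<le> \<gamma> * cube_avg n f"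
  shows "- (2 ^ m) * (\<gamma> * cube_avg n f) \<le> lift_expect m n \<sigma> E f"
proof -
  define T where "T = {j. j < m \<and> \<sigma> j \<in> J}"
  have T: "T \<subseteq> {..<m}" "finite T" "card T \<le> d" using J by (auto simp: T_def)
  have nonneg: "0 \<le> cube_avg n f" by (intro cube_avg_nonneg f)
  have "0 \<le> (\<Sum>\<beta>\<in>Pow T. fourier n f (\<sigma> ` \<beta>) * E (chi \<beta>))"
  proof (rule local_expectation_junta_nonneg[OF E T(1,3)])
    fix z assume z: "z \<in> hcube m"
    have "(\<Sum>\<beta>\<in>Pow T. fourier n f (\<sigma> ` \<beta>) * chi \<beta> z)
        = (\<Sum>\<beta>\<in>Pow T. cube_avg n (\<lambda>x. f x * (chi \<beta> (pull m \<sigma> x) * chi \<beta> z)))"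
    proof (intro sum.cong refl)
      fix \<beta> assume "\<beta> \<in> Pow T"
      then have "\<beta> \<subseteq> {..<m}" using T by auto
      then show "fourier n f (\<sigma> ` \<beta>) * chi \<beta> z
          = cube_avg n (\<lambda>x. f x * (chi \<beta> (pull m \<sigma> x) * chi \<beta> z))"
        using chi_pull[OF inj]
        by (simp add: fourier_def cube_avg_def sum_distrib_right mult.assoc)
    qed
    \<comment> \<open>The product is \<open>2 ^ card T\<close> times the indicator that the
      pulled-back assignment agrees with \<open>z\<close> on \<open>T\<close>, so the whole is a
      conditional mean of \<open>f\<close>.\<close>
    also have "\<dots> = cube_avg n (\<lambda>x. f x * (\<Prod>i\<in>T. 1 + pull m \<sigma> x i * z i))"
      by (simp add: cube_avg_sum[symmetric] sum_distrib_left[symmetric] sum_Pow_chi_mult T(2))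
    also have "\<dots> \<ge> 0"
    proof (intro cube_avg_nonneg mult_nonneg_nonneg prod_nonneg ballI f)
      fix x i assume x: "x \<in> hcube n" and "i \<in> T"
      then have i: "i < m" using T by auto
      show "0 \<le> 1 + pull m \<sigma> x i * z i"
        using hcube_coord[OF pull_in_hcube[OF \<sigma> x] i] hcube_coord[OF z i] by auto
    qed
    finally show "0 \<le> (\<Sum>\<beta>\<in>Pow T. fourier n f (\<sigma> ` \<beta>) * chi \<beta> z)" .
  qed
  moreover have "- (2 ^ m) * (\<gamma> * cube_avg n f)
      \<le> (\<Sum>\<beta>\<in>Pow {..<m} - Pow T. fourier n f (\<sigma> ` \<beta>) * E (chi \<beta>))"
  proof -
    have "- (2 ^ m) * (\<gamma> * cube_avg n f) = (\<Sum>\<beta>\<in>Pow {..<m}. - (\<gamma> * cube_avg n f))"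
      by (simp add: card_Pow)
    also have "\<dots> \<le> (\<Sum>\<beta>\<in>Pow {..<m} - Pow T. - (\<gamma> * cube_avg n f))"
      unfolding sum_negf neg_le_iff_le using \<gamma> nonneg by (intro sum_mono2) auto
    also have "\<dots> \<le> (\<Sum>\<beta>\<in>Pow {..<m} - Pow T. fourier n f (\<sigma> ` \<beta>) * E (chi \<beta>))"
    proof (rule sum_mono)
      fix \<beta> assume \<beta>: "\<beta> \<in> Pow {..<m} - Pow T"
      show "- (\<gamma> * cube_avg n f) \<le> fourier n f (\<sigma> ` \<beta>) * E (chi \<beta>)"
      proof (cases "card \<beta> \<le> d")
        case True
        have "card (\<sigma> ` \<beta>) \<le> d"
          using True card_image_le[of \<beta> \<sigma>] \<beta> finite_subset[of \<beta> "{..<m}"] by fastforce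
        moreover have "\<sigma> ` \<beta> \<subseteq> {..<n}" "\<not> \<sigma> ` \<beta> \<subseteq> J" using \<sigma> \<beta> by (auto simp: T_def)
        ultimately have "\<bar>fourier n f (\<sigma> ` \<beta>)\<bar> \<le> \<gamma> * cube_avg n f" using small by blast
        then have "\<bar>fourier n f (\<sigma> ` \<beta>)\<bar> * \<bar>E (chi \<beta>)\<bar> \<le> (\<gamma> * cube_avg n f) * 1"
          using local_expectation_chi_bound[OF E, of \<beta>] \<beta> \<gamma> nonneg by (intro mult_mono) auto
        then show ?thesis by (simp add: abs_mult[symmetric] abs_le_iff)
      next
        case False
        then have "E (chi \<beta>) = 0" using E \<beta> by (simp add: local_expectation_def)
        then show ?thesis using \<gamma> nonneg by simp
      qed
    qed
    finally show ?thesis .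
  qed
  moreover have "lift_expect m n \<sigma> E f
     = (\<Sum>\<beta>\<in>Pow {..<m} - Pow T. fourier n f (\<sigma> ` \<beta>) * E (chi \<beta>))
       + (\<Sum>\<beta>\<in>Pow T. fourier n f (\<sigma> ` \<beta>) * E (chi \<beta>))"
    unfolding lift_expect_def using T by (intro sum.subset_diff) auto
  ultimately show ?thesis by linarith
qed

section \<open>Choosing an injection that meets every cover at most \<open>d\<close> times\<close>

text \<open>A union bound over the pairs of an index \<open>i\<close> and a set \<open>T\<close> of
  \<open>Suc d\<close> variables: there are at most \<open>R * 2 ^ m\<close> pairs, and for each of
  them at most \<open>K ^ Suc d * N ^ (m - Suc d)\<close> of the \<open>N ^ m\<close> candidates
  send all of \<open>T\<close> into \<open>J i\<close>.\<close>

lemma spread_injection: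
  fixes J :: "nat \<Rightarrow> nat set"
  assumes small: "R * 2 ^ m * K ^ Suc d < N ^ Suc d" and mN: "m * N \<le> n"
    and J: "\<And>i. i < R \<Longrightarrow> finite (J i) \<and> card (J i) \<le> K"
  obtains \<sigma> where "inj_on \<sigma> {..<m}" "\<sigma> ` {..<m} \<subseteq> {..<n}"
    "\<And>i. i < R \<Longrightarrow> card {j. j < m \<and> \<sigma> j \<in> J i} \<le> d"
proof -
  have N: "N > 0" using small by (cases N) auto
  \<comment> \<open>\<open>\<sigma> j = j * N + \<tau> j\<close> is injective for every \<open>\<tau>\<close>, as its values lie in disjoint blocks\<close>
  define S where "S = {..<m} \<rightarrow>\<^sub>E {..<N}"
  \<comment> \<open>The event that \<open>\<sigma>\<close> sends all of \<open>T\<close> into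
    \<open>J i\<close> constrains each \<open>\<tau> j\<close> separately, so \<open>bad i T\<close>
    is a product set and its size is a product.\<close>
  define blk where "blk T i j = (if j \<in> T then {t. t < N \<and> j * N + t \<in> J i} else {..<N})" for T i j
  define bad where "bad i T = PiE {..<m} (blk T i)" for i T
  define \<T> where "\<T> = {T. T \<subseteq> {..<m} \<and> card T = Suc d}"
  have finT: "finite \<T>" unfolding \<T>_def by simp
  have finblk: "finite (blk T i j)" for T i j by (simp add: blk_def)
  have card_bad: "card (bad i T) \<le> K ^ Suc d * N ^ (m - Suc d)" if i: "i < R" and T: "T \<in> \<T>" for i T
  proof -
    have T': "T \<subseteq> {..<m}" "card T = Suc d" using T by (auto simp: \<T>_def)
    have le: "card (blk T i j) \<le> K" if "j \<in> T" for j
    proof -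
      have "card (blk T i j) \<le> card (J i)"
        using that J[OF i] by (intro card_inj_on_le[of "\<lambda>t. j * N + t"]) (auto simp: blk_def inj_on_def)
      then show ?thesis using J[OF i] by simp
    qed
    have "card (bad i T) = (\<Prod>j<m. card (blk T i j))"
      by (simp add: bad_def card_PiE)
    also have "\<dots> = (\<Prod>j\<in>{..<m} - T. card (blk T i j)) * (\<Prod>j\<in>T. card (blk T i j))"
      using T' by (intro prod.subset_diff) auto
    also have "\<dots> \<le> N ^ (m - Suc d) * K ^ Suc d"
    proof (rule mult_mono)
      have "(\<Prod>j\<in>{..<m} - T. card (blk T i j)) = N ^ card ({..<m} - T)"
        by (simp add: blk_def)
      then show "(\<Prod>j\<in>{..<m} - T. card (blk T i j)) \<le> N ^ (m - Suc d)"
        using T' by (simp add: card_Diff_subset finite_subset[OF T'(1)])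
      have "(\<Prod>j\<in>T. card (blk T i j)) \<le> (\<Prod>j\<in>T. K)"
        by (intro prod_mono) (auto simp: le)
      then show "(\<Prod>j\<in>T. card (blk T i j)) \<le> K ^ Suc d" using T' by simp
    qed auto
    finally show ?thesis by (simp add: mult.commute)
  qed
  have "card (\<Union>(i, T)\<in>{..<R} \<times> \<T>. bad i T) < card S"
  proof (cases "\<T> = {}")
    \<comment> \<open>Here \<open>m \<le> d\<close>, so no set of \<open>Suc d\<close> variables
      exists and the union is empty. In the other case \<open>Suc d \<le> m\<close> makes
      \<open>m - Suc d\<close> a true difference.\<close>
    case True
    then show ?thesis using N by (simp add: S_def card_PiE)
  next
    case False
    then obtain T where "T \<subseteq> {..<m}" "card T = Suc d" by (auto simp: \<T>_def)
    then have dm: "Suc d \<le> m" using card_mono[of "{..<m}" T] by simp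
    have "card \<T> \<le> card (Pow {..<m})" unfolding \<T>_def by (intro card_mono) auto
    then have cT: "card \<T> \<le> 2 ^ m" by (simp add: card_Pow)
    have "card (\<Union>(i, T)\<in>{..<R} \<times> \<T>. bad i T) \<le> (\<Sum>(i, T)\<in>{..<R} \<times> \<T>. card (bad i T))"
      using card_UN_le[of "{..<R} \<times> \<T>" "\<lambda>(i, T). bad i T"] finT by (simp add: case_prod_unfold)
    also have "\<dots> \<le> (\<Sum>(i, T)\<in>{..<R} \<times> \<T>. K ^ Suc d * N ^ (m - Suc d))"
      by (intro sum_mono) (auto intro: card_bad[simplified])
    also have "\<dots> = R * card \<T> * (K ^ Suc d * N ^ (m - Suc d))"
      by (simp add: case_prod_unfold card_cartesian_product)
    also have "\<dots> \<le> R * 2 ^ m * (K ^ Suc d * N ^ (m - Suc d))"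
      using cT by (intro mult_le_mono) auto
    also have "\<dots> = (R * 2 ^ m * K ^ Suc d) * N ^ (m - Suc d)" by (simp add: mult_ac)
    also have "\<dots> < N ^ Suc d * N ^ (m - Suc d)"
      using small N by (intro mult_strict_right_mono) auto
    also have "\<dots> = N ^ m" using power_add[of N "Suc d" "m - Suc d"] dm by simp
    finally show ?thesis by (simp add: S_def card_PiE)
  qed
  moreover have "finite (\<Union>(i, T)\<in>{..<R} \<times> \<T>. bad i T)"
    using finT finblk by (auto simp: bad_def intro!: finite_PiE)
  ultimately have "\<not> S \<subseteq> (\<Union>(i, T)\<in>{..<R} \<times> \<T>. bad i T)"
    using card_mono leD by blast
  then obtain \<tau> where \<tau>: "\<tau> \<in> S" "\<And>i T. i < R \<Longrightarrow> T \<in> \<T> \<Longrightarrow> \<tau> \<notin> bad i T" by auto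
  have \<tau>N: "\<tau> j < N" if "j < m" for j using \<tau>(1) that by (auto simp: S_def)
  define \<sigma> where "\<sigma> j = j * N + \<tau> j" for j
  show ?thesis
  proof
    have "\<sigma> j div N = j" if "j < m" for j using \<tau>N[OF that] by (simp add: \<sigma>_def)
    then show "inj_on \<sigma> {..<m}" by (metis inj_onI lessThan_iff)
    show "\<sigma> ` {..<m} \<subseteq> {..<n}"
    proof (intro image_subsetI, unfold lessThan_iff)
      fix j assume j: "j < m"
      have "\<sigma> j < Suc j * N" using \<tau>N[OF j] by (simp add: \<sigma>_def)
      also have "\<dots> \<le> m * N" using j by (intro mult_le_mono1) simp
      finally show "\<sigma> j < n" using mN by simp
    qed
    fix i assume i: "i < R"
    show "card {j. j < m \<and> \<sigma> j \<in> J i} \<le> d"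
    proof (rule ccontr)
      assume "\<not> ?thesis"
      then have "Suc d \<le> card {j. j < m \<and> \<sigma> j \<in> J i}" by simp
      then obtain T where T: "T \<subseteq> {j. j < m \<and> \<sigma> j \<in> J i}" "card T = Suc d"
        using obtain_subset_with_card_n by metis
      then have "T \<in> \<T>" by (auto simp: \<T>_def)
      moreover have "\<tau> \<in> bad i T"
        unfolding bad_def
      proof (rule PiE_I)
        show "\<tau> j \<in> blk T i j" if "j \<in> {..<m}" for j
          using that T(1) \<tau>N[of j] by (auto simp: blk_def \<sigma>_def)
        show "\<tau> j = undefined" if "j \<notin> {..<m}" for j
          using that \<tau>(1) by (auto simp: S_def)
      qed
      ultimately show False using \<tau>(2)[OF i] by blast
    qed
  qed
qed

text \<open>With \<open>s = sqrt (real n)\<close>, \<open>R\<close> is at most \<open>s ^ d\<close>,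
  the floor is of order \<open>ln n\<close>, and \<open>n div m\<close> is of order
  \<open>s\<^sup>2\<close>; powers of \<open>s\<close> beat powers of the logarithm. The quantifier
  over \<open>R\<close> stands inside because the size of a relaxation varies with
  \<open>n\<close>.\<close>

lemma eventually_spread_bound:
  fixes \<eta> \<gamma> :: real
  assumes "m > 0" "\<eta> > 0"
  shows "\<forall>\<^sub>F n in sequentially. \<forall>R. real R \<le> real n powr (real d / 2) \<longrightarrow>
    R * 2 ^ m * nat \<lfloor>real d * 4 * ln (2 ^ m * real (Suc R) / \<eta>) / \<gamma>\<^sup>2\<rfloor> ^ Suc d < (n div m) ^ Suc d"
proof -
  \<comment> \<open>The quantity \<open>a + b * ln (real n)\<close> bounds the argument of the floor
    by way of \<open>Suc R \<le> 2 * n ^ d\<close>. The maximum with 0 in \<open>u\<close> matches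
    \<open>nat\<close>, which sends negative values to 0.\<close>
  define b where "b = 4 * real d * real d / \<gamma>\<^sup>2"
  define a where "a = 4 * real d / \<gamma>\<^sup>2 * ln (2 ^ m * 2 / \<eta>)"
  define u where "u n = max 0 (a + b * ln (real n))" for n
  have "((\<lambda>n. (2 ^ m * 2 * real m) * (a * (1 / sqrt (real n)) + b * (ln (real n) / sqrt (real n)))) \<longlongrightarrow>
      (2 ^ m * 2 * real m) * (a * 0 + b * 0)) sequentially"
    by (intro tendsto_intros) real_asymp+
  then have "\<forall>\<^sub>F n in sequentially.
      (2 ^ m * 2 * real m) * (a * (1 / sqrt (real n)) + b * (ln (real n) / sqrt (real n))) < 1"
    by (rule order_tendstoD) simp
  moreover have "\<forall>\<^sub>F n in sequentially. n \<ge> 2 * m" by (rule eventually_ge_at_top)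
  ultimately show ?thesis
  proof eventually_elim
    case (elim n)
    define s where "s = sqrt (real n)"
    have n: "real n \<ge> 1" "s > 0" "s * s = real n" "s \<ge> 1" "n > 0"
      using elim(2) assms(1) by (auto simp: s_def)
    have u: "2 ^ m * u n < s / (2 * real m)"
    proof (cases "0 \<le> a + b * ln (real n)")
      case True
      have "(2 ^ m * 2 * real m) * (a + b * ln (real n)) < s"
        using elim(1) n(2) unfolding s_def[symmetric] by (simp add: field_simps)
      then show ?thesis using True assms(1) by (simp add: u_def field_simps)
    qed (use n assms in \<open>simp add: u_def\<close>)
    \<comment> \<open>From \<open>n \<ge> 2 * m\<close> the quotient \<open>n div m\<close> is at
      least 1, so rounding down loses at most a factor 2.\<close>
    have N: "real n / (2 * real m) \<le> real (n div m)"
    proof -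
      have "n < m * Suc (n div m)"
        using dividend_less_times_div[OF assms(1), of n] by simp
      moreover have "Suc (n div m) \<le> 2 * (n div m)"
        using elim(2) assms(1) by (simp add: Suc_le_eq div_greater_zero_iff)
      ultimately have "n \<le> m * (2 * (n div m))"
        by (meson le_trans less_imp_le mult_le_mono2)
      then have "real n \<le> real (m * (2 * (n div m)))" by (rule of_nat_mono)
      then show ?thesis using assms(1) by (simp add: field_simps)
    qed
    show ?case
    proof (intro allI impI)
      fix R :: nat
      assume R: "real R \<le> real n powr (real d / 2)"
      define K where "K = nat \<lfloor>real d * 4 * ln (2 ^ m * real (Suc R) / \<eta>) / \<gamma>\<^sup>2\<rfloor>"
      have Rs: "real R \<le> s ^ d"
      proof -
        have "real n powr (real d / 2) = (real n powr (1 / 2)) powr real d"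
          by (simp add: powr_powr)
        also have "\<dots> = s ^ d" using n by (simp add: powr_realpow powr_half_sqrt s_def)
        finally show ?thesis using R by simp
      qed
      have "s * 1 \<le> s * s" using n by (intro mult_left_mono) auto
      then have "s ^ d \<le> real n ^ d" using n by (intro power_mono) auto
      then have "real (Suc R) \<le> 2 * real n ^ d"
        using Rs one_le_power[OF n(1), of d] by simp
      then have "2 ^ m * real (Suc R) / \<eta> \<le> 2 ^ m * (2 * real n ^ d) / \<eta>"
        using assms by (intro divide_right_mono mult_left_mono) auto
      then have "ln (2 ^ m * real (Suc R) / \<eta>) \<le> ln (2 ^ m * 2 / \<eta> * real n ^ d)"
        using assms n by (subst ln_le_cancel_iff) (auto intro: divide_pos_pos)
      also have "\<dots> = ln (2 ^ m * 2 / \<eta>) + real d * ln (real n)"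
        using assms n by (subst ln_mult) (auto simp: ln_realpow)
      finally have "4 * real d / \<gamma>\<^sup>2 * ln (2 ^ m * real (Suc R) / \<eta>)
          \<le> 4 * real d / \<gamma>\<^sup>2 * (ln (2 ^ m * 2 / \<eta>) + real d * ln (real n))"
        by (intro mult_left_mono) auto
      also have "\<dots> = a + b * ln (real n)"
        by (simp add: a_def b_def algebra_simps)
      finally have le: "real d * 4 * ln (2 ^ m * real (Suc R) / \<eta>) / \<gamma>\<^sup>2 \<le> u n"
        by (simp add: u_def mult_ac)
      have "real K \<le> max 0 (real d * 4 * ln (2 ^ m * real (Suc R) / \<eta>) / \<gamma>\<^sup>2)"
        unfolding K_def by linarith
      then have Ku: "real K \<le> u n" using le by (simp add: u_def)
      have "real (R * 2 ^ m * K ^ Suc d) \<le> s ^ d * 2 ^ m * u n ^ Suc d"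
        unfolding of_nat_mult of_nat_power of_nat_numeral
        using Rs Ku n by (intro mult_mono power_mono) auto
      \<comment> \<open>Giving all factors the exponent \<open>Suc d\<close> reduces the claim to a
        comparison of bases, which is the fact \<open>u\<close>.\<close>
      also have "\<dots> \<le> s ^ Suc d * (2 ^ m) ^ Suc d * u n ^ Suc d"
        using n by (intro mult_right_mono mult_mono power_increasing self_le_power) (auto simp: u_def)
      also have "\<dots> = (s * (2 ^ m * u n)) ^ Suc d"
        by (simp only: power_mult_distrib mult.assoc)
      also have "\<dots> < (s * (s / (2 * real m))) ^ Suc d"
        using u n by (intro power_strict_mono mult_strict_left_mono) (auto simp: u_def)
      also have "\<dots> = (real n / (2 * real m)) ^ Suc d" by (simp add: n(3))
      also have "\<dots> \<le> real (n div m) ^ Suc d" by (intro power_mono N) simp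
      also have "\<dots> = real ((n div m) ^ Suc d)" by simp
      finally show "R * 2 ^ m * K ^ Suc d < (n div m) ^ Suc d"
        using of_nat_less_iff by blast
    qed
  qed
qed

section \<open>Repairing the violated inequalities\<close>

text \<open>The weights mix the lift with the uniform distribution and with point masses at the
  maxima of the slacks, the latter two having total weight \<open>\<eta>\<close> each. Below the
  threshold the lift is at least \<open>- \<eta>\<close> times the mean, which the uniform part
  offsets. Above it, the point mass at the maximum contributes more than \<open>2 ^ m\<close> times
  the mean, which offsets the crude bound.\<close>

lemma perturbed_weights:
  fixes q :: "nat \<Rightarrow> (nat \<Rightarrow> real) \<Rightarrow> real"
  assumes E: "local_expectation m d E" and inj: "inj_on \<sigma> {..<m}" and \<sigma>: "\<sigma> ` {..<m} \<subseteq> {..<n}"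
    and \<eta>: "0 < \<eta>" "\<eta> \<le> 1 / 2"
    and q: "\<And>i x. i < R \<Longrightarrow> x \<in> hcube n \<Longrightarrow> 0 \<le> q i x"
    and smooth: "\<And>i. i < R \<Longrightarrow> (\<And>x. x \<in> hcube n \<Longrightarrow> q i x \<le> 2 ^ m * real (Suc R) / \<eta> * cube_avg n (q i)) \<Longrightarrow>
      card {j. j < m \<and> \<sigma> j \<in> J i} \<le> d \<and>
      (\<forall>\<alpha>. \<alpha> \<subseteq> {..<n} \<longrightarrow> card \<alpha> \<le> d \<longrightarrow> \<not> \<alpha> \<subseteq> J i \<longrightarrow>
        \<bar>fourier n (q i) \<alpha>\<bar> \<le> \<eta> / 2 ^ m * cube_avg n (q i))"
  obtains w where "(\<Sum>x\<in>hcube n. w x) = 1"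
    "\<And>i. i < R \<Longrightarrow> 0 \<le> (\<Sum>x\<in>hcube n. w x * q i x)"
    "\<And>g. (\<And>z. z \<in> hcube m \<Longrightarrow> 0 \<le> g z) \<Longrightarrow>
      (1 - 2 * \<eta>) * E g \<le> (\<Sum>x\<in>hcube n. w x * g (pull m \<sigma> x))"
proof -
  obtain w0 where w0: "\<And>f. lift_expect m n \<sigma> E f = (\<Sum>x\<in>hcube n. w0 x * f x)"
    using lift_expect_eq_sum by blast
  define pt where "pt i = (SOME x. x \<in> hcube n \<and> (\<forall>y\<in>hcube n. q i y \<le> q i x))" for i
  have "\<exists>x. x \<in> hcube n \<and> (\<forall>y\<in>hcube n. q i y \<le> q i x)" for i
  proof -
    have "Max (q i ` hcube n) \<in> q i ` hcube n" by (intro Max_in) auto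
    then obtain x where "Max (q i ` hcube n) = q i x" "x \<in> hcube n" by (rule imageE)
    moreover have "q i y \<le> Max (q i ` hcube n)" if "y \<in> hcube n" for y
      using that by (intro Max_ge) auto
    ultimately show ?thesis by metis
  qed
  then have pt: "pt i \<in> hcube n" "y \<in> hcube n \<Longrightarrow> q i y \<le> q i (pt i)" for i y
    using someI_ex[of "\<lambda>x. x \<in> hcube n \<and> (\<forall>y\<in>hcube n. q i y \<le> q i x)"] unfolding pt_def by blast+
  \<comment> \<open>The point masses range over \<open>{..R}\<close> instead of \<open>{..<R}\<close> to cover \<open>R = 0\<close>.\<close>
  define w where "w x = (1 - 2 * \<eta>) * w0 x + \<eta> / 2 ^ n +
    \<eta> / real (Suc R) * (\<Sum>i\<le>R. if pt i = x then 1 else 0)" for x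
  have w: "(\<Sum>x\<in>hcube n. w x * f x)
    = (1 - 2 * \<eta>) * lift_expect m n \<sigma> E f + \<eta> * cube_avg n f
      + \<eta> / real (Suc R) * (\<Sum>i\<le>R. f (pt i))" for f
  proof -
    have "(\<Sum>x\<in>hcube n. (\<Sum>i\<le>R. if pt i = x then 1 else 0) * f x)
      = (\<Sum>i\<le>R. \<Sum>x\<in>hcube n. if pt i = x then f x else 0)"
      unfolding sum_distrib_right by (subst sum.swap) (intro sum.cong refl, simp)
    also have "\<dots> = (\<Sum>i\<le>R. f (pt i))" using pt(1) by simp
    finally have *: "(\<Sum>x\<in>hcube n. (\<Sum>i\<le>R. if pt i = x then 1 else 0) * f x) = (\<Sum>i\<le>R. f (pt i))" .
    have "(\<Sum>x\<in>hcube n. w x * f x) = (\<Sum>x\<in>hcube n. (1 - 2 * \<eta>) * (w0 x * f x) + \<eta> * (f x / 2 ^ n)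
        + \<eta> / real (Suc R) * ((\<Sum>i\<le>R. if pt i = x then 1 else 0) * f x))"
      unfolding w_def by (intro sum.cong refl) 
        (simp only: distrib_right mult.assoc times_divide_eq_left times_divide_eq_right)
    also have "\<dots> = (1 - 2 * \<eta>) * lift_expect m n \<sigma> E f + \<eta> * cube_avg n f
      + \<eta> / real (Suc R) * (\<Sum>i\<le>R. f (pt i))"
      unfolding sum.distrib sum_distrib_left[symmetric] w0 cube_avg_def * sum_divide_distrib ..
    finally show ?thesis .
  qed
  show ?thesis
  proof
    have "lift_expect m n \<sigma> E (\<lambda>x. 1) = 1"
      using lift_expect_pull[OF E inj \<sigma>, of "\<lambda>z. 1"] E by (simp add: local_expectation_def)
    then show "(\<Sum>x\<in>hcube n. w x) = 1"
      using w[of "\<lambda>x. 1"] by (simp add: cube_avg_const)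
  next
    fix g :: "(nat \<Rightarrow> real) \<Rightarrow> real"
    assume g: "\<And>z. z \<in> hcube m \<Longrightarrow> 0 \<le> g z"
    have "0 \<le> \<eta> * cube_avg n (\<lambda>x. g (pull m \<sigma> x))"
      using \<eta> pull_in_hcube[OF \<sigma>] by (intro mult_nonneg_nonneg cube_avg_nonneg g) auto
    moreover have "0 \<le> \<eta> / real (Suc R) * (\<Sum>i\<le>R. g (pull m \<sigma> (pt i)))"
      using \<eta> pull_in_hcube[OF \<sigma> pt(1)] by (intro mult_nonneg_nonneg sum_nonneg g) auto
    ultimately show "(1 - 2 * \<eta>) * E g \<le> (\<Sum>x\<in>hcube n. w x * g (pull m \<sigma> x))"
      unfolding w lift_expect_pull[OF E inj \<sigma>] by linarith
  next
    fix i assume i: "i < R"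
    define F where "F = cube_avg n (q i)"
    have F: "0 \<le> F" unfolding F_def by (intro cube_avg_nonneg q i)
    \<comment> \<open>The extra summand \<open>i' = R\<close> evaluates \<open>q i\<close> at
      \<open>pt R\<close>, which is still a point of the cube, so it is nonnegative like the
      others.\<close>
    have pts: "q i (pt i) \<le> (\<Sum>i'\<le>R. q i (pt i'))"
      using i pt(1) q[OF i] by (intro member_le_sum) auto
    have pts0: "0 \<le> (\<Sum>i'\<le>R. q i (pt i'))"
      using pt(1) q[OF i] by (intro sum_nonneg) auto
    show "0 \<le> (\<Sum>x\<in>hcube n. w x * q i x)"
    proof (cases "q i (pt i) \<le> 2 ^ m * real (Suc R) / \<eta> * F")
      case True
      then have "q i x \<le> 2 ^ m * real (Suc R) / \<eta> * cube_avg n (q i)" if "x \<in> hcube n" for x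
        using pt(2)[OF that, of i] unfolding F_def by linarith
      note sm = smooth[OF i this]
      have "- (2 ^ m) * (\<eta> / 2 ^ m * F) \<le> lift_expect m n \<sigma> E (q i)"
        unfolding F_def
      proof (rule lift_expect_junta_ge[OF E inj \<sigma>])
        show "card {j. j < m \<and> \<sigma> j \<in> J i} \<le> d" using sm by blast
        show "\<bar>fourier n (q i) \<alpha>\<bar> \<le> \<eta> / 2 ^ m * cube_avg n (q i)"
          if "\<alpha> \<subseteq> {..<n}" "card \<alpha> \<le> d" "\<not> \<alpha> \<subseteq> J i" for \<alpha>
          using sm that by blast
      qed (use \<eta> q i in auto)
      then have "(1 - 2 * \<eta>) * (- (\<eta> * F)) \<le> (1 - 2 * \<eta>) * lift_expect m n \<sigma> E (q i)"
        using \<eta> by (intro mult_left_mono) auto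
      moreover have "(1 - 2 * \<eta>) * (\<eta> * F) \<le> 1 * (\<eta> * F)"
        using \<eta> F by (intro mult_right_mono) auto
      moreover have "0 \<le> \<eta> / real (Suc R) * (\<Sum>i'\<le>R. q i (pt i'))"
        using \<eta> pts0 by (intro mult_nonneg_nonneg) auto
      ultimately show ?thesis unfolding w F_def[symmetric] by simp
    next
      case False
      then have "\<eta> / real (Suc R) * (2 ^ m * real (Suc R) / \<eta> * F)
          \<le> \<eta> / real (Suc R) * (\<Sum>i'\<le>R. q i (pt i'))"
        using \<eta> pts by (intro mult_left_mono) auto
      moreover have "\<eta> / real (Suc R) * (2 ^ m * real (Suc R) / \<eta> * F) = 2 ^ m * F"
        using \<eta> by simp
      moreover have "(1 - 2 * \<eta>) * (- (2 ^ m) * F) \<le> (1 - 2 * \<eta>) * lift_expect m n \<sigma> E (q i)"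
        unfolding F_def using \<eta> q i by (intro mult_left_mono lift_expect_ge[OF E \<sigma>]) auto
      moreover have "1 * (- (2 ^ m) * F) \<le> (1 - 2 * \<eta>) * (- (2 ^ m) * F)"
        using \<eta> F by (intro mult_right_mono_neg) auto
      moreover have "0 \<le> \<eta> * F" using \<eta> F by simp
      ultimately show ?thesis unfolding w F_def[symmetric] by linarith
    qed
  qed
qed

section \<open>Planting an instance on more variables\<close>

definition plant :: "(nat \<Rightarrow> nat) \<Rightarrow> csp_instance \<Rightarrow> csp_instance" where
  "plant \<sigma> I = map (map_prod id (map \<sigma>)) I"

lemma plant_in_instances:
  assumes "I \<in> csp_instances Preds k m" "inj_on \<sigma> {..<m}" "\<sigma> ` {..<m} \<subseteq> {..<n}"
  shows "plant \<sigma> I \<in> csp_instances Preds k n"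
proof -
  have "(P, map \<sigma> xs) \<in> csp_constraints Preds k n" if "(P, xs) \<in> csp_constraints Preds k m" for P xs
  proof -
    have xs: "P \<in> Preds" "length xs = k" "distinct xs" "set xs \<subseteq> {..<m}"
      using that by (auto simp: csp_constraints_def)
    moreover have "inj_on \<sigma> (set xs)" using assms(2) xs(4) by (rule inj_on_subset)
    moreover have "\<sigma> ` set xs \<subseteq> {..<n}" using assms(3) xs(4) by blast
    ultimately show ?thesis by (simp add: csp_constraints_def distinct_map)
  qed
  then show ?thesis using assms(1) by (auto simp: csp_instances_def plant_def)
qed

lemma csp_val_plant:
  assumes "I \<in> csp_instances Preds k m"
  shows "csp_val (plant \<sigma> I) x = csp_val I (pull m \<sigma> x)"
proof -
  have "constraint_val (map_prod id (map \<sigma>) C) x = constraint_val C (pull m \<sigma> x)" if "C \<in> set I" for C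
  proof -
    obtain P xs where C: "C = (P, xs)" by (cases C)
    have "xs ! j < m" if "j < length xs" for j
      using assms \<open>C \<in> set I\<close> C that nth_mem unfolding csp_instances_def csp_constraints_def by fastforce
    then have "(\<lambda>j\<in>{..<length xs}. x (map \<sigma> xs ! j)) = (\<lambda>j\<in>{..<length xs}. pull m \<sigma> x (xs ! j))"
      by (auto simp: pull_def restrict_def fun_eq_iff)
    then show ?thesis by (simp add: C)
  qed
  then have "map (\<lambda>C. constraint_val C x) (plant \<sigma> I) = map (\<lambda>C. constraint_val C (pull m \<sigma> x)) I"
    by (simp add: plant_def)
  moreover have "length (plant \<sigma> I) = length I" by (simp add: plant_def)
  ultimately show ?thesis unfolding csp_val_def by presburger
qed

text \<open>A nonnegative objective can only gain from the uniform and point-mass parts of the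
  weights.\<close>

lemma csp_val_nonneg:
  assumes "I \<in> csp_instances Preds k m" "Preds \<subseteq> predicates k" "x \<in> hcube m"
  shows "0 \<le> csp_val I x"
proof -
  have "0 \<le> constraint_val C x" if "C \<in> set I" for C
  proof -
    obtain P xs where C: "C = (P, xs)" by (cases C)
    have P: "P \<in> predicates k" "length xs = k" "set xs \<subseteq> {..<m}"
      using assms(1,2) that C unfolding csp_instances_def csp_constraints_def by auto
    have "(\<lambda>j\<in>{..<k}. x (xs ! j)) \<in> hcube k"
      unfolding hcube_def
    proof (rule restrict_PiE_iff[THEN iffD2], intro ballI)
      fix j assume "j \<in> {..<k}"
      then have "xs ! j \<in> set xs" using P(2) by simp
      then have "xs ! j < m" using P(3) by auto
      then show "x (xs ! j) \<in> {-1, 1}" using hcube_coord[OF assms(3)] by auto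
    qed
    then have "P (\<lambda>j\<in>{..<k}. x (xs ! j)) \<in> {0, 1}"
      using P(1) unfolding predicates_def by (rule PiE_mem[rotated])
    then show ?thesis using C P(2) by auto
  qed
  then show ?thesis unfolding csp_val_def by (intro divide_nonneg_nonneg sum_list_nonneg) auto
qed

text \<open>Every value of the planted instance is a value of \<open>I\<close> at a pulled-back
  assignment, so planting keeps the optimum at most \<open>s\<close>.\<close>

lemma csp_opt_plant:
  assumes "I \<in> csp_instances Preds k m" "\<sigma> ` {..<m} \<subseteq> {..<n}"
  shows "csp_opt n (plant \<sigma> I) \<le> csp_opt m I"
  unfolding csp_opt_def
  unfolding csp_val_plant[OF assms(1)]
  by (intro Max_mono image_subsetI imageI pull_in_hcube[OF assms(2)]) auto

section \<open>Feasible points from signed weights\<close>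

lemma scalar_prod_weighted_sum:
  fixes v :: "real vec"
  shows "v \<bullet> vec D (\<lambda>j. \<Sum>x\<in>S. w x * (u x $ j)) = (\<Sum>x\<in>S. w x * (\<Sum>j<D. v $ j * (u x $ j)))"
proof -
  have "v \<bullet> vec D (\<lambda>j. \<Sum>x\<in>S. w x * (u x $ j)) = (\<Sum>j<D. \<Sum>x\<in>S. v $ j * (w x * (u x $ j)))"
    by (simp add: scalar_prod_def sum_distrib_left atLeast0LessThan)
  also have "\<dots> = (\<Sum>x\<in>S. \<Sum>j<D. v $ j * (w x * (u x $ j)))" by (rule sum.swap)
  also have "\<dots> = (\<Sum>x\<in>S. w x * (\<Sum>j<D. v $ j * (u x $ j)))"
    by (simp add: sum_distrib_left mult.left_commute)
  finally show ?thesis .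
qed

text \<open>Since the weights sum to 1, the slack of each inequality at the combined point
  \<open>y\<close> is the weighted sum of its slacks at the assignments. So \<open>y\<close> is
  feasible once these sums are nonnegative, even if single weights are negative.\<close>

lemma lp_value_ge_weighted:
  assumes L: "is_lp_relaxation Preds k n L" and I: "I \<in> csp_instances Preds k n"
    and w1: "(\<Sum>x\<in>hcube n. w x) = 1"
    and w: "\<And>i. i < lp_size L \<Longrightarrow>
      0 \<le> (\<Sum>x\<in>hcube n. w x * (lp_rhs L $ i - row (lp_mat L) i \<bullet> lp_asg L x))"
  shows "ereal (\<Sum>x\<in>hcube n. w x * csp_val I x) \<le> lp_value L I"
proof -
  let ?D = "lp_dim L"
  define y where "y = vec ?D (\<lambda>j. \<Sum>x\<in>hcube n. w x * (lp_asg L x $ j))"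
  have asg: "lp_asg L x \<in> carrier_vec ?D" if "x \<in> hcube n" for x
    using L that unfolding is_lp_relaxation_def lp_polyhedron_def by auto
  have y: "v \<bullet> y = (\<Sum>x\<in>hcube n. w x * (v \<bullet> lp_asg L x))" for v
    unfolding y_def scalar_prod_weighted_sum
    by (intro sum.cong refl) (simp add: scalar_prod_def atLeast0LessThan carrier_vecD[OF asg])
  have "y \<in> lp_polyhedron L"
    unfolding lp_polyhedron_def less_eq_vec_def
  proof (intro CollectI conjI allI impI)
    show "y \<in> carrier_vec ?D" by (simp add: y_def)
    show dims: "dim_vec (lp_mat L *\<^sub>v y) = dim_vec (lp_rhs L)"
      using L unfolding is_lp_relaxation_def by auto
    fix i assume "i < dim_vec (lp_rhs L)"
    then have i: "i < lp_size L" using dims by (simp add: lp_size_def)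
    have "(lp_mat L *\<^sub>v y) $ i = (\<Sum>x\<in>hcube n. w x * (row (lp_mat L) i \<bullet> lp_asg L x))"
      using i by (simp add: lp_size_def y)
    also have "\<dots> \<le> (\<Sum>x\<in>hcube n. w x * lp_rhs L $ i)"
      using w[OF i] by (simp add: right_diff_distrib sum_subtractf)
    also have "\<dots> = lp_rhs L $ i" by (simp add: sum_distrib_right[symmetric] w1)
    finally show "(lp_mat L *\<^sub>v y) $ i \<le> lp_rhs L $ i" .
  qed
  then have "ereal (lp_inst L I \<bullet> y) \<le> lp_value L I"
    unfolding lp_value_def by (rule SUP_upper)
  moreover have "lp_inst L I \<bullet> y = (\<Sum>x\<in>hcube n. w x * csp_val I x)"
    unfolding y using L I unfolding is_lp_relaxation_def by (intro sum.cong refl) simp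
  ultimately show ?thesis by simp
qed

lemma lp_slack_nonneg:
  assumes L: "is_lp_relaxation Preds k n L" and "x \<in> hcube n" "i < lp_size L"
  shows "0 \<le> lp_rhs L $ i - row (lp_mat L) i \<bullet> lp_asg L x"
proof -
  have "lp_asg L x \<in> lp_polyhedron L" "dim_vec (lp_rhs L) = lp_size L"
    using L assms(2) by (auto simp: is_lp_relaxation_def)
  then have "(lp_mat L *\<^sub>v lp_asg L x) $ i \<le> lp_rhs L $ i"
    using assms(3) by (simp add: lp_polyhedron_def less_eq_vec_def del: index_mult_mat_vec)
  then show ?thesis using assms(3) by (simp add: lp_size_def)
qed

section \<open>From a Sherali-Adams gap to a lower bound on LP size\<close>

theorem theorem3p1:
  fixes d k :: nat and Preds :: "((nat \<Rightarrow> real) \<Rightarrow> real) set" and c s :: real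
  assumes "d \<ge> 1" and "k \<le> d"
    and "finite Preds" and "Preds \<subseteq> predicates k"
    and "\<forall>\<^sub>F n in sequentially. \<not> SA_achieves Preds k n d c s"
  shows "\<not> (\<exists>L :: nat \<Rightarrow> lp_relaxation.
            (\<forall>n\<ge>1. is_lp_relaxation Preds k n (L n) \<and>
                    real (lp_size (L n)) \<le> real n powr (real d / 2)) \<and>
            (\<forall>\<^sub>F n in sequentially. lp_achieves Preds k n (L n) c s))"
proof (intro notI, elim exE conjE)
  fix Ls :: "nat \<Rightarrow> lp_relaxation"
  assume Ls: "\<forall>n\<ge>1. is_lp_relaxation Preds k n (Ls n) \<and>
      real (lp_size (Ls n)) \<le> real n powr (real d / 2)"
    and achieves: "\<forall>\<^sub>F n in sequentially. lp_achieves Preds k n (Ls n) c s"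
  \<comment> \<open>The number \<open>m\<close> and its hard instance are fixed first, and only
    \<open>n\<close> grows afterwards; \<open>m \<ge> 1\<close> allows the division into blocks of
    length \<open>n div m\<close>.\<close>
  have "\<forall>\<^sub>F m in sequentially. \<not> SA_achieves Preds k m d c s \<and> m \<ge> 1"
    using assms(5) eventually_ge_at_top by (rule eventually_conj)
  then obtain m where m: "\<not> SA_achieves Preds k m d c s" "m \<ge> 1"
    using eventually_happens'[OF sequentially_bot] by blast
  then obtain I where I: "I \<in> csp_instances Preds k m" "csp_opt m I \<le> s" "ereal c < SA_value m d I"
    by (auto simp: SA_achieves_def not_le)
  then obtain E where E: "local_expectation m d E" and cE: "c < E (csp_val I)"
    by (auto simp: SA_value_def less_SUP_iff)
  define E0 where "E0 = E (csp_val I)"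
  \<comment> \<open>This choice makes \<open>2 * \<eta> * E0\<close> at most half the gap
    \<open>E0 - c\<close>, whatever the sign of \<open>E0\<close>; the denominator also keeps
    \<open>\<eta> \<le> 1 / 2\<close>.\<close>
  define \<eta> where "\<eta> = (E0 - c) / (4 * (\<bar>E0\<bar> + \<bar>c\<bar> + 1))"
  have \<eta>: "0 < \<eta>" "\<eta> \<le> 1 / 2"
    using cE by (auto simp: \<eta>_def E0_def field_simps)
  have c_less: "c < (1 - 2 * \<eta>) * E0"
  proof -
    have "\<eta> * E0 \<le> \<eta> * (\<bar>E0\<bar> + \<bar>c\<bar> + 1)" using \<eta> by (intro mult_left_mono) auto
    also have "\<dots> = (E0 - c) / 4" by (simp add: \<eta>_def field_simps)
    finally show ?thesis using cE by (simp add: E0_def algebra_simps)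
  qed
  \<comment> \<open>At most \<open>2 ^ m\<close> coefficients cost \<open>\<gamma>\<close> times the
    mean each, so together they cost at most \<open>\<eta>\<close> times the mean.\<close>
  define \<gamma> where "\<gamma> = \<eta> / 2 ^ m"
  have \<gamma>: "0 < \<gamma>" "\<gamma> \<le> 1"
    using \<eta> order_trans[of \<eta> 1 "2 ^ m"] by (auto simp: \<gamma>_def divide_le_eq)
  have "\<forall>\<^sub>F n in sequentially. lp_achieves Preds k n (Ls n) c s \<and> n \<ge> 1 \<and>
    (\<forall>R. real R \<le> real n powr (real d / 2) \<longrightarrow>
      R * 2 ^ m * nat \<lfloor>real d * 4 * ln (2 ^ m * real (Suc R) / \<eta>) / \<gamma>\<^sup>2\<rfloor> ^ Suc d < (n div m) ^ Suc d)"
    using m(2) \<eta>(1)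
    by (intro eventually_conj achieves eventually_ge_at_top eventually_spread_bound) auto
  then obtain n where n: "lp_achieves Preds k n (Ls n) c s" "n \<ge> 1" and
    bound: "\<And>R. real R \<le> real n powr (real d / 2) \<Longrightarrow>
      R * 2 ^ m * nat \<lfloor>real d * 4 * ln (2 ^ m * real (Suc R) / \<eta>) / \<gamma>\<^sup>2\<rfloor> ^ Suc d < (n div m) ^ Suc d"
    using eventually_happens'[OF sequentially_bot] by blast
  define L where "L = Ls n"
  define R where "R = lp_size L"
  define B where "B = 2 ^ m * real (Suc R) / \<eta>"
  define q where "q i x = lp_rhs L $ i - row (lp_mat L) i \<bullet> lp_asg L x" for i x
  have L: "is_lp_relaxation Preds k n L" "real R \<le> real n powr (real d / 2)"
    using Ls n(2) by (auto simp: L_def R_def)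
  have q: "0 \<le> q i x" if "i < R" "x \<in> hcube n" for i x
    using lp_slack_nonneg[OF L(1)] that by (simp add: q_def R_def)
  have B: "1 \<le> B"
  proof -
    have "1 * 1 \<le> 2 ^ m * real (Suc R)" by (intro mult_mono) auto
    then show ?thesis using \<eta> by (simp add: B_def le_divide_eq)
  qed
  \<comment> \<open>The Fourier condition is guarded by the threshold so that every
    \<open>i < R\<close> has a cover: a slack whose maximum exceeds \<open>B\<close> times its mean
    takes the empty set.\<close>
  define covers where "covers i J \<longleftrightarrow> J \<subseteq> {..<n} \<and> card J \<le> nat \<lfloor>real d * 4 * ln B / \<gamma>\<^sup>2\<rfloor> \<and>
    ((\<forall>x\<in>hcube n. q i x \<le> B * cube_avg n (q i)) \<longrightarrow>
      (\<forall>\<alpha>. \<alpha> \<subseteq> {..<n} \<longrightarrow> card \<alpha> \<le> d \<longrightarrow> \<not> \<alpha> \<subseteq> J \<longrightarrow> \<bar>fourier n (q i) \<alpha>\<bar> \<le> \<gamma> * cube_avg n (q i)))" for i J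
  have "\<exists>J. covers i J" if i: "i < R" for i
  proof (cases "\<forall>x\<in>hcube n. q i x \<le> B * cube_avg n (q i)")
    case True
    obtain J where "J \<subseteq> {..<n}" "real (card J) \<le> real d * 4 * ln B / \<gamma>\<^sup>2"
      "\<And>\<alpha>. \<alpha> \<subseteq> {..<n} \<Longrightarrow> card \<alpha> \<le> d \<Longrightarrow> \<not> \<alpha> \<subseteq> J \<Longrightarrow> \<bar>fourier n (q i) \<alpha>\<bar> \<le> \<gamma> * cube_avg n (q i)"
      using junta_cover[of n "q i" B \<gamma> d] q[OF i] True \<gamma> B by blast
    then have "covers i J" unfolding covers_def using le_nat_floor by blast
    then show ?thesis ..
  next
    case False
    then have "covers i {}" unfolding covers_def by auto
    then show ?thesis ..
  qed
  then obtain J where J: "\<And>i. i < R \<Longrightarrow> covers i (J i)" by metis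
  have mn: "m * (n div m) \<le> n" by simp
  have Jfin: "finite (J i) \<and> card (J i) \<le> nat \<lfloor>real d * 4 * ln B / \<gamma>\<^sup>2\<rfloor>" if "i < R" for i
    using J[OF that] unfolding covers_def by (meson finite_lessThan finite_subset)
  obtain \<sigma> where inj: "inj_on \<sigma> {..<m}" and \<sigma>: "\<sigma> ` {..<m} \<subseteq> {..<n}"
    and few: "\<And>i. i < R \<Longrightarrow> card {j. j < m \<and> \<sigma> j \<in> J i} \<le> d"
    using spread_injection[where J = J, OF bound[OF L(2), folded B_def] mn Jfin] by blast
  obtain w where w1: "(\<Sum>x\<in>hcube n. w x) = 1"
    and wq: "\<And>i. i < R \<Longrightarrow> 0 \<le> (\<Sum>x\<in>hcube n. w x * q i x)"
    and wE: "\<And>g. (\<And>z. z \<in> hcube m \<Longrightarrow> 0 \<le> g z) \<Longrightarrow>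
      (1 - 2 * \<eta>) * E g \<le> (\<Sum>x\<in>hcube n. w x * g (pull m \<sigma> x))"
  proof (rule perturbed_weights[OF E inj \<sigma> \<eta>, of R q J])
    fix i
    assume i: "i < R"
      and "\<And>x. x \<in> hcube n \<Longrightarrow> q i x \<le> 2 ^ m * real (Suc R) / \<eta> * cube_avg n (q i)"
    then show "card {j. j < m \<and> \<sigma> j \<in> J i} \<le> d \<and>
      (\<forall>\<alpha>. \<alpha> \<subseteq> {..<n} \<longrightarrow> card \<alpha> \<le> d \<longrightarrow> \<not> \<alpha> \<subseteq> J i \<longrightarrow>
        \<bar>fourier n (q i) \<alpha>\<bar> \<le> \<eta> / 2 ^ m * cube_avg n (q i))"
      using few[OF i] J[OF i] unfolding covers_def B_def \<gamma>_def by blast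
  qed (use q in auto)
  have planted: "plant \<sigma> I \<in> csp_instances Preds k n" by (rule plant_in_instances[OF I(1) inj \<sigma>])
  have "c < (1 - 2 * \<eta>) * E0" by (rule c_less)
  also have "\<dots> \<le> (\<Sum>x\<in>hcube n. w x * csp_val (plant \<sigma> I) x)"
    unfolding E0_def csp_val_plant[OF I(1)] by (intro wE csp_val_nonneg[OF I(1) assms(4)])
  finally have "ereal c < ereal (\<Sum>x\<in>hcube n. w x * csp_val (plant \<sigma> I) x)" by simp
  also have "\<dots> \<le> lp_value L (plant \<sigma> I)"
    using lp_value_ge_weighted[OF L(1) planted w1] wq by (simp add: q_def R_def)
  also have "\<dots> \<le> ereal c"
    using n(1) planted csp_opt_plant[OF I(1) \<sigma>] I(2) unfolding lp_achieves_def L_def by auto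
  finally show False by simp
qed

end
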